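(* Let $d\ge 1$, $\mu>0$, let $g:\mathbb{R}^d\to[0,1]$ be a non-increasing radial function with $0<\int_{\mathbb{R}^d}g(x)\,dx<\infty$, and let $v\in\mathbb{R}^d$, $v\neq 0$. Then the groups shared by vertices located at $0$ and $v$ form an inhomogeneous Poisson process on $\mathbb{R}^d$ with intensity function $x\mapsto\mu g(x)g(v-x)$.
   Context: A function $g:\mathbb{R}^d\to[0,1]$ is a non-increasing radial function if $g(x)=g(y)$ whenever $|x|=|y|$ and $g(x)\leq g(y)$ whenever $|x|\geq|y|$, where $|\cdot|$ is the Euclidean norm. Model. Groups are the points of a homogeneous Poisson process $\mathcal{U}$ on $\mathbb{R}^d$ with intensity $\mu$. Vertices are the points of a set $\mathcal{V}$, which is an independent homogeneous Poisson process on $\mathbb{R}^d$; here $\mathcal{V}$ is assumed to have vertices located at $0$ and at $v$ (i.e. these two points are added to the process). Given $\mathcal{V}$ and $\mathcal{U}$, each vertex $w\in\mathcal{V}$ and each group $u\in\mathcal{U}$ are connected independently with probability $g(w-u)$. A group $u\in\mathcal{U}$ is shared by $0$ and $v$ if it is connected to both $0$ and $v$. *)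

theory Defs
  imports "HOL-Probability.Probability"
begin

definition nonincreasing_radial :: "('a::real_normed_vector \<Rightarrow> real) \<Rightarrow> bool" where
  "nonincreasing_radial g \<longleftrightarrow>
     (\<forall>x y. norm x = norm y \<longrightarrow> g x = g y) \<and> (\<forall>x y. norm x \<ge> norm y \<longrightarrow> g x \<le> g y)"

definition locally_finite_set :: "'a::metric_space set \<Rightarrow> bool" where
  "locally_finite_set S \<longleftrightarrow> (\<forall>B. bounded B \<longrightarrow> finite (S \<inter> B))"

text \<open>
  Simple point processes are random locally finite sets, i.e. measurable maps into the following
  space of point configurations, whose \<open>\<sigma>\<close>-algebra is generated by the counts in bounded Borel
  sets. Poisson processes on Euclidean space whose intensity measure has a density are simple,
  so nothing is lost by using sets instead of counting measures.
\<close>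

definition config_space :: "'a::metric_space set measure" where
  "config_space = sigma {S. locally_finite_set S}
     {{S. locally_finite_set S \<and> card (S \<inter> B) = k} | B k. B \<in> sets borel \<and> bounded B}"

text \<open>
  The count in a bounded Borel set \<open>B\<close> is Poisson distributed with mean \<open>\<integral>\<^sub>B f\<close>.
  The point probabilities are written out because the mean may be \<open>0\<close>, which the library's
  \<open>poisson_pmf\<close> excludes (here \<open>0 ^ 0 = 1\<close> gives the point mass at \<open>0\<close>).
\<close>

definition poisson_process ::
  "'w measure \<Rightarrow> ('a::euclidean_space \<Rightarrow> real) \<Rightarrow> ('w \<Rightarrow> 'a set) \<Rightarrow> bool" where
  "poisson_process M f N \<longleftrightarrow>
     prob_space M \<and>
     f \<in> borel_measurable borel \<and> (\<forall>x. 0 \<le> f x) \<and>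
     (\<forall>B. B \<in> sets borel \<and> bounded B \<longrightarrow> set_integrable lborel B f) \<and>
     N \<in> measurable M config_space \<and>
     (\<forall>B k. B \<in> sets borel \<and> bounded B \<longrightarrow>
        measure M {\<omega> \<in> space M. card (N \<omega> \<inter> B) = k} =
          (LINT x:B|lborel. f x) ^ k / fact k * exp (- (LINT x:B|lborel. f x))) \<and>
     (\<forall>(n::nat) B. (\<forall>i<n. B i \<in> sets borel \<and> bounded (B i)) \<and> disjoint_family_on B {..<n} \<longrightarrow>
        prob_space.indep_vars M (\<lambda>_. count_space UNIV) (\<lambda>i \<omega>. card (N \<omega> \<inter> B i)) {..<n})"

definition homogeneous_poisson_process ::
  "'w measure \<Rightarrow> real \<Rightarrow> ('w \<Rightarrow> 'a::euclidean_space set) \<Rightarrow> bool" where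
  "homogeneous_poisson_process M \<mu> N \<longleftrightarrow> poisson_process M (\<lambda>_. \<mu>) N"

text \<open>The \<open>\<sigma>\<close>-algebra on the sample space generated by the vertex and group processes.\<close>

definition points_algebra ::
  "'w measure \<Rightarrow> ('w \<Rightarrow> 'a::metric_space set) \<Rightarrow> ('w \<Rightarrow> 'a set) \<Rightarrow> 'w measure" where
  "points_algebra M V U =
     vimage_algebra (space M) (\<lambda>\<omega>. (V \<omega>, U \<omega>)) (config_space \<Otimes>\<^sub>M config_space)"

text \<open>
  \<open>conn \<omega> w u\<close> means that vertex \<open>w\<close> and group \<open>u\<close> are connected. Given \<open>V\<close> and \<open>U\<close>, the
  connections are independent and have probabilities \<open>g (w - u)\<close>: for every finite family of
  distinct vertex-group pairs, the conditional probability that all of them are connected is the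
  product of the individual probabilities. (Over all finite families this is conditional mutual
  independence; one-element families give the marginals.) Since the points are random, a pair is
  given by a measurable choice \<open>(w i, u i)\<close> depending on \<open>V\<close> and \<open>U\<close> only. The choice need only
  be a choice of distinct pairs on an event \<open>A\<close> determined by \<open>V\<close> and \<open>U\<close>, such as the event
  that a given region contains exactly one group.
\<close>

definition independently_connected ::
  "'w measure \<Rightarrow> ('a::euclidean_space \<Rightarrow> real) \<Rightarrow> ('w \<Rightarrow> 'a set) \<Rightarrow> ('w \<Rightarrow> 'a set) \<Rightarrow>
     ('w \<Rightarrow> 'a \<Rightarrow> 'a \<Rightarrow> bool) \<Rightarrow> bool" where
  "independently_connected M g V U conn \<longleftrightarrow>
     (\<forall>(n::nat) A w u.
        A \<in> sets (points_algebra M V U) \<and>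
        (\<forall>i<n. w i \<in> borel_measurable (points_algebra M V U) \<and>
               u i \<in> borel_measurable (points_algebra M V U)) \<and>
        (\<forall>\<omega>\<in>A. (\<forall>i<n. w i \<omega> \<in> V \<omega> \<and> u i \<omega> \<in> U \<omega>) \<and> inj_on (\<lambda>i. (w i \<omega>, u i \<omega>)) {..<n})
        \<longrightarrow>
        {\<omega> \<in> A. \<forall>i<n. conn \<omega> (w i \<omega>) (u i \<omega>)} \<in> sets M \<and>
        (AE \<omega> in M. \<omega> \<in> A \<longrightarrow>
           real_cond_exp M (points_algebra M V U)
             (indicator {\<omega> \<in> A. \<forall>i<n. conn \<omega> (w i \<omega>) (u i \<omega>)}) \<omega> =
           (\<Prod>i<n. g (w i \<omega> - u i \<omega>))))"

definition shared_groups :: "'a set \<Rightarrow> ('a \<Rightarrow> 'a \<Rightarrow> bool) \<Rightarrow> 'a \<Rightarrow> 'a \<Rightarrow> 'a set" where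
  "shared_groups U conn w w' = {u \<in> U. conn w u \<and> conn w' u}"

end

theory Submission
  imports Defs
begin

text \<open>
  Conditionally on the positions of vertices and groups, a group at \<open>x\<close> is connected to both \<open>0\<close>
  and \<open>v\<close> with probability \<open>h x = g x * g (v - x)\<close>, independently of the other groups, because the
  pairs \<open>(0, x)\<close> and \<open>(v, x)\<close> are distinct for \<open>v \<noteq> 0\<close> and \<open>g\<close> is even. The shared groups are thus an
  independent thinning of the Poisson process \<open>U\<close> with retention probability \<open>h\<close>, and a thinned
  Poisson process is Poisson with the intensity multiplied by \<open>h\<close> (\<open>poisson_process_retained\<close>).

  The thinning theorem is proved with generating functionals. For Borel \<open>f\<close> with values in \<open>[0, 2]\<close> and
  a bounded Borel set \<open>B\<close>, the thinned set \<open>S\<close> satisfies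
  \<open>E (\<Prod>x\<in>S \<inter> B. 1 - f x) = E (\<Prod>x\<in>U \<inter> B. 1 - f x * h x)\<close> (\<open>expectation_prod_retained\<close>), and for a Poisson
  process with intensity \<open>\<phi>\<close> the right-hand side is \<open>exp (- \<integral>\<^sub>B \<phi> f h)\<close> (\<open>poisson_process_pgfl\<close>). If \<open>f\<close> equals
  \<open>1 - s i\<close> on disjoint sets \<open>B i\<close> and \<open>0\<close> elsewhere, this is the joint generating function of the
  counts of \<open>S\<close> in the \<open>B i\<close>. It is a product of Poisson generating functions, so the counts are
  independent Poisson variables (\<open>poisson_joint_pmf_of_joint_pgf\<close>). The arguments \<open>s i\<close> range over \<open>[-1, 1]\<close>,
  hence the bound \<open>2\<close> for \<open>f\<close>; all the products then have absolute value at most \<open>1\<close> and limits pass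
  through expectations by dominated convergence.

  The hypothesis on the connections concerns finitely many points chosen measurably from the
  configuration. Such a choice comes from a grid: the point of \<open>U\<close> in a cell, on the event that
  the cell contains exactly one. For a fine enough grid every point of \<open>U \<inter> B\<close> is alone in its
  cell (\<open>eventually_grid_isolates_points\<close>), so products over points are limits of products over cells.
  A product over cells expands into a sum over sets of cells, and to each summand the
  conditional independence applies.
\<close>

section \<open>Point configurations\<close>

lemma space_config_space: "space config_space = {S. locally_finite_set S}"
  unfolding config_space_def by (subst space_measure_of) auto

lemma measurable_count_config:
  fixes B :: "'a::metric_space set"
  assumes "B \<in> sets borel" "bounded B"
  shows "(\<lambda>S. card (S \<inter> B)) \<in> measurable config_space (count_space UNIV)"
proof (rule measurable_count_space_eq2_countable[THEN iffD2], simp_all, intro conjI allI)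
  fix k
  have "{S. locally_finite_set S \<and> card (S \<inter> B) = k} \<in> sets config_space"
    unfolding config_space_def using assms by (intro in_measure_of) blast+
  moreover have "(\<lambda>S. card (S \<inter> B)) -` {k} \<inter> space config_space
      = {S. locally_finite_set S \<and> card (S \<inter> B) = k}"
    by (auto simp: space_config_space)
  ultimately show "(\<lambda>S. card (S \<inter> B)) -` {k} \<inter> space config_space \<in> sets config_space"
    by simp
qed

lemma measurable_config_spaceI:
  fixes N :: "'w \<Rightarrow> 'a::metric_space set"
  assumes lf: "\<And>\<omega>. \<omega> \<in> space M \<Longrightarrow> locally_finite_set (N \<omega>)"
    and count: "\<And>B. B \<in> sets borel \<Longrightarrow> bounded B \<Longrightarrow>
      (\<lambda>\<omega>. card (N \<omega> \<inter> B)) \<in> measurable M (count_space UNIV)"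
  shows "N \<in> measurable M config_space"
  unfolding config_space_def
proof (rule measurable_measure_of)
  fix y :: "'a set set"
  assume "y \<in> {{S. locally_finite_set S \<and> card (S \<inter> B) = k} |B k. B \<in> sets borel \<and> bounded B}"
  then obtain B k where B: "B \<in> sets borel" "bounded B"
    and y: "y = {S. locally_finite_set S \<and> card (S \<inter> B) = k}"
    by auto
  have "N -` y \<inter> space M = (\<lambda>\<omega>. card (N \<omega> \<inter> B)) -` {k} \<inter> space M"
    using lf by (auto simp: y)
  then show "N -` y \<inter> space M \<in> sets M"
    using measurable_sets[OF count[OF B], of "{k}"] by simp
qed (use lf in auto)

lemma locally_finite_set_config:
  assumes "N \<in> measurable M config_space" "\<omega> \<in> space M"
  shows "locally_finite_set (N \<omega>)"
  using measurable_space[OF assms] by (simp add: space_config_space)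

lemma locally_finite_setD: "locally_finite_set S \<Longrightarrow> bounded B \<Longrightarrow> finite (S \<inter> B)"
  by (simp add: locally_finite_set_def)

lemma measurable_count:
  fixes N :: "'w \<Rightarrow> 'a::metric_space set"
  assumes "N \<in> measurable M config_space" "B \<in> sets borel" "bounded B"
  shows "(\<lambda>\<omega>. card (N \<omega> \<inter> B)) \<in> measurable M (count_space UNIV)"
  by (rule measurable_compose[OF assms(1) measurable_count_config[OF assms(2,3)]])

text \<open>
  Adding a point changes a count only if the point is new, and whether it is new can be read
  off the count in a singleton.
\<close>

lemma measurable_insert_point:
  fixes N :: "'w \<Rightarrow> 'a::metric_space set"
  assumes N: "N \<in> measurable M config_space"
  shows "(\<lambda>\<omega>. insert a (N \<omega>)) \<in> measurable M config_space"
proof (rule measurable_config_spaceI)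
  fix \<omega> assume "\<omega> \<in> space M"
  then show "locally_finite_set (insert a (N \<omega>))"
    using locally_finite_set_config[OF N] by (auto simp: locally_finite_set_def Int_insert_left)
next
  fix B :: "'a set" assume B: "B \<in> sets borel" "bounded B"
  have eq: "card (insert a (N \<omega>) \<inter> B) =
      card (N \<omega> \<inter> B) + (if a \<in> B \<and> card (N \<omega> \<inter> {a}) = 0 then 1 else 0)"
    if "\<omega> \<in> space M" for \<omega>
  proof -
    have "finite (N \<omega> \<inter> B)"
      using locally_finite_set_config[OF N that] B(2) by (rule locally_finite_setD)
    then show ?thesis
      by (auto simp: Int_insert_left insert_absorb)
  qed
  have [measurable]: "(\<lambda>\<omega>. card (N \<omega> \<inter> B)) \<in> measurable M (count_space UNIV)"
    "(\<lambda>\<omega>. card (N \<omega> \<inter> {a})) \<in> measurable M (count_space UNIV)"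
    by (rule measurable_count[OF N B], rule measurable_count[OF N]) simp_all
  have "(\<lambda>\<omega>. card (N \<omega> \<inter> B) + (if a \<in> B \<and> card (N \<omega> \<inter> {a}) = 0 then 1 else 0))
      \<in> measurable M (count_space UNIV)"
    by measurable
  then show "(\<lambda>\<omega>. card (insert a (N \<omega>) \<inter> B)) \<in> measurable M (count_space UNIV)"
    by (subst measurable_cong[OF eq])
qed

text \<open>
  The value \<open>0\<close> is a default that keeps the selection defined on the whole configuration space,
  where it is measurable; it is meaningful on the event that \<open>C\<close> contains exactly one point.
\<close>

definition sole_point :: "'a::zero set \<Rightarrow> 'a set \<Rightarrow> 'a" where
  "sole_point C S = (if card (S \<inter> C) = 1 then the_elem (S \<inter> C) else 0)"

lemma sole_point_mem: "card (S \<inter> C) = 1 \<Longrightarrow> sole_point C S \<in> S \<inter> C"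
  by (metis card_1_singletonE insertI1 sole_point_def the_elem_eq)

lemma sole_point_eqI: "S \<inter> C = {x} \<Longrightarrow> sole_point C S = x"
  by (simp add: sole_point_def)

text \<open>
  This writes the selection in terms of counts, which are what generates the \<open>\<sigma>\<close>-algebra of
  configurations; measurability of the selection follows.
\<close>

lemma sole_point_mem_iff:
  "sole_point C S \<in> D \<longleftrightarrow> (if card (S \<inter> C) = 1 then card (S \<inter> (C \<inter> D)) = 1 else 0 \<in> D)"
proof (cases "card (S \<inter> C) = 1")
  case True
  then obtain x where x: "S \<inter> C = {x}"
    by (metis card_1_singletonE)
  then have *: "S \<inter> (C \<inter> D) = (if x \<in> D then {x} else {})"
    by auto
  have "sole_point C S = x"
    unfolding sole_point_def x by simp
  then show ?thesis
    unfolding * True by simp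
next
  case False
  then show ?thesis by (simp only: sole_point_def if_False)
qed

lemma measurable_sole_point [measurable]:
  fixes C :: "'a::real_normed_vector set"
  assumes C: "C \<in> sets borel" "bounded C"
  shows "sole_point C \<in> measurable config_space borel"
proof (rule measurableI)
  fix D :: "'a set" assume D: "D \<in> sets borel"
  have eq: "sole_point C -` D \<inter> space config_space =
     {S \<in> space config_space. if card (S \<inter> C) = 1 then card (S \<inter> (C \<inter> D)) = 1 else 0 \<in> D}"
    by (rule set_eqI)
      (simp only: vimage_eq Int_iff mem_Collect_eq sole_point_mem_iff conj_commute)
  have one: "{S \<in> space config_space. card (S \<inter> E) = 1} \<in> sets config_space"
    if "E \<in> sets borel" "bounded E" for E :: "'a set"
    using measurable_sets[OF measurable_count_config[OF that], of "{1}"]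
    by (simp add: vimage_def Int_def conj_commute)
  have "{S \<in> space config_space. if card (S \<inter> C) = 1 then card (S \<inter> (C \<inter> D)) = 1 else 0 \<in> D}
     = ({S \<in> space config_space. card (S \<inter> C) = 1} \<inter> {S \<in> space config_space. card (S \<inter> (C \<inter> D)) = 1})
       \<union> (if 0 \<in> D then space config_space - {S \<in> space config_space. card (S \<inter> C) = 1} else {})"
    by (auto simp del: One_nat_def)
  also have "\<dots> \<in> sets config_space"
    using one[OF C] one[of "C \<inter> D"] C D by (simp add: bounded_Int)
  finally show "sole_point C -` D \<inter> space config_space \<in> sets config_space"
    unfolding eq .
qed auto

section \<open>Isolating the points of a configuration by a grid\<close>

text \<open>
  For \<open>m > 0\<close> this is the label of the cube of side \<open>1 / m\<close> that contains \<open>x\<close>. The restriction to \<open>Basis\<close>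
  makes the labels that occur in a bounded set finite in number.
\<close>

definition grid_index :: "nat \<Rightarrow> 'a::euclidean_space \<Rightarrow> 'a \<Rightarrow> int" where
  "grid_index m x = (\<lambda>b\<in>Basis. \<lfloor>real m * (x \<bullet> b)\<rfloor>)"

definition grid_cell :: "'a::euclidean_space set \<Rightarrow> nat \<Rightarrow> ('a \<Rightarrow> int) \<Rightarrow> 'a set" where
  "grid_cell B m q = {x \<in> B. grid_index m x = q}"

lemma grid_cell_subset: "grid_cell B m q \<subseteq> B"
  by (auto simp: grid_cell_def)

lemma bounded_grid_cell: "bounded B \<Longrightarrow> bounded (grid_cell B m q)"
  by (rule bounded_subset[OF _ grid_cell_subset])

lemma grid_index_extensional: "grid_index m x \<in> extensional Basis"
  by (simp add: grid_index_def)

lemma borel_grid_cell: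
  fixes B :: "'a::euclidean_space set"
  assumes B: "B \<in> sets borel"
  shows "grid_cell B m q \<in> sets borel"
proof (cases "q \<in> extensional Basis")
  case True
  then have "grid_index m x = q \<longleftrightarrow> (\<forall>b\<in>Basis. \<lfloor>real m * (x \<bullet> b)\<rfloor> = q b)" for x
    using grid_index_extensional[of m x]
    by (auto simp: grid_index_def intro: extensionalityI[where A = Basis])
  then have "grid_cell B m q = B \<inter> (\<Inter>b\<in>Basis. {x. \<lfloor>real m * (x \<bullet> b)\<rfloor> = q b})"
    by (auto simp: grid_cell_def)
  moreover have "{x :: 'a. \<lfloor>real m * (x \<bullet> b)\<rfloor> = q b} \<in> sets borel" for b
    by measurable
  then have "(\<Inter>b\<in>Basis. {x :: 'a. \<lfloor>real m * (x \<bullet> b)\<rfloor> = q b}) \<in> sets borel"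
    by (intro sets.finite_INT) simp_all
  ultimately show ?thesis
    using B by simp
next
  case False
  then have "grid_cell B m q = {}"
    using grid_index_extensional unfolding grid_cell_def by blast
  then show ?thesis by simp
qed

lemma finite_grid_index:
  fixes B :: "'a::euclidean_space set"
  assumes "bounded B"
  shows "finite (grid_index m ` B)"
proof -
  obtain R where R: "\<And>x. x \<in> B \<Longrightarrow> norm x \<le> R"
    using assms by (auto simp: bounded_iff)
  have "grid_index m ` B \<subseteq> (\<Pi>\<^sub>E b\<in>Basis. {\<lfloor>- (real m * R)\<rfloor>..\<lfloor>real m * R\<rfloor>})"
  proof safe
    fix x b :: 'a assume x: "x \<in> B" and b: "b \<in> Basis"
    have "\<bar>x \<bullet> b\<bar> \<le> R"
      using Basis_le_norm[OF b, of x] R[OF x] by linarith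
    then have "\<bar>real m * (x \<bullet> b)\<bar> \<le> real m * R"
      by (simp add: abs_mult mult_left_mono)
    then show "grid_index m x b \<in> {\<lfloor>- (real m * R)\<rfloor>..\<lfloor>real m * R\<rfloor>}"
      using b by (auto simp: grid_index_def intro!: floor_mono)
  qed (auto simp: grid_index_def)
  then show ?thesis
    by (rule finite_subset) (auto intro!: finite_PiE)
qed

text \<open>
  Two points that differ by \<open>\<delta>\<close> in some coordinate lie in different cells as soon as \<open>m > 1 / \<delta>\<close>.
\<close>

lemma eventually_grid_index_neq:
  fixes x y :: "'a::euclidean_space"
  assumes "x \<noteq> y"
  shows "eventually (\<lambda>m. grid_index m x \<noteq> grid_index m y) sequentially"
proof -
  obtain b where b: "b \<in> Basis" "x \<bullet> b \<noteq> y \<bullet> b"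
    using assms euclidean_eqI by blast
  define \<delta> where "\<delta> = \<bar>x \<bullet> b - y \<bullet> b\<bar>"
  have "\<delta> > 0" using b by (simp add: \<delta>_def)
  have "eventually (\<lambda>m. real m > 1 / \<delta>) sequentially"
    using filterlim_real_sequentially by (auto simp: filterlim_at_top_dense)
  then show ?thesis
  proof eventually_elim
    case (elim m)
    then have "1 < real m * \<delta>"
      using \<open>\<delta> > 0\<close> by (simp add: field_simps)
    also have "real m * \<delta> = \<bar>real m * (x \<bullet> b) - real m * (y \<bullet> b)\<bar>"
      unfolding \<delta>_def by (simp add: abs_mult flip: right_diff_distrib)
    finally have "\<lfloor>real m * (x \<bullet> b)\<rfloor> \<noteq> \<lfloor>real m * (y \<bullet> b)\<rfloor>"
      by linarith
    then show ?case
      using b(1) by (metis grid_index_def restrict_apply')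
  qed
qed

lemma eventually_inj_on_grid_index:
  fixes F :: "'a::euclidean_space set"
  assumes "finite F"
  shows "eventually (\<lambda>m. inj_on (grid_index m) F) sequentially"
proof -
  have "eventually (\<lambda>m. \<forall>x\<in>F. \<forall>y\<in>F. x \<noteq> y \<longrightarrow> grid_index m x \<noteq> grid_index m y) sequentially"
    using assms
  proof (intro eventually_ball_finite ballI)
    fix x y :: 'a
    show "eventually (\<lambda>m. x \<noteq> y \<longrightarrow> grid_index m x \<noteq> grid_index m y) sequentially"
      using eventually_grid_index_neq[of x y] by (cases "x = y") auto
  qed
  then show ?thesis
    by eventually_elim (auto simp: inj_on_def)
qed

text \<open>
  Once the grid separates the finitely many points of \<open>S \<inter> B\<close>, the occupied cells correspond
  to these points.
\<close>

lemma eventually_grid_isolates_points: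
  fixes S B :: "'a::euclidean_space set"
  assumes "finite (S \<inter> B)"
  shows "eventually (\<lambda>m. bij_betw (\<lambda>q. sole_point (grid_cell B m q) S)
     {q \<in> grid_index m ` B. card (S \<inter> grid_cell B m q) = 1} (S \<inter> B)) sequentially"
  using eventually_inj_on_grid_index[OF assms]
proof eventually_elim
  case (elim m)
  have cell: "S \<inter> grid_cell B m (grid_index m x) = {x}" if "x \<in> S \<inter> B" for x
    using that elim by (auto simp: grid_cell_def inj_on_def)
  show ?case
  proof (rule bij_betwI[where g = "grid_index m"])
    show "(\<lambda>q. sole_point (grid_cell B m q) S)
      \<in> {q \<in> grid_index m ` B. card (S \<inter> grid_cell B m q) = 1} \<rightarrow> S \<inter> B"
      using sole_point_mem grid_cell_subset by fastforce
    show "grid_index m \<in> S \<inter> B \<rightarrow> {q \<in> grid_index m ` B. card (S \<inter> grid_cell B m q) = 1}"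
      using cell by auto
    show "grid_index m (sole_point (grid_cell B m q) S) = q"
      if "q \<in> {q \<in> grid_index m ` B. card (S \<inter> grid_cell B m q) = 1}" for q
      using sole_point_mem[of S "grid_cell B m q"] that by (auto simp: grid_cell_def)
    show "sole_point (grid_cell B m (grid_index m x)) S = x" if "x \<in> S \<inter> B" for x
      using cell[OF that] by (rule sole_point_eqI)
  qed
qed

lemma eventually_prod_grid_eq:
  fixes T B :: "'a::euclidean_space set" and a :: "'a \<Rightarrow> real"
  assumes B: "bounded B" and fin: "finite (T \<inter> B)"
  shows "eventually (\<lambda>m. (\<Prod>q\<in>grid_index m ` B.
      if card (T \<inter> grid_cell B m q) = 1 then a (sole_point (grid_cell B m q) T) else 1)
    = (\<Prod>x\<in>T \<inter> B. a x)) sequentially"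
  using eventually_grid_isolates_points[OF fin]
proof eventually_elim
  case (elim m)
  have "(\<Prod>q\<in>grid_index m ` B.
      if card (T \<inter> grid_cell B m q) = 1 then a (sole_point (grid_cell B m q) T) else 1)
    = (\<Prod>q\<in>{q \<in> grid_index m ` B. card (T \<inter> grid_cell B m q) = 1}. a (sole_point (grid_cell B m q) T))"
    by (rule prod.inter_filter[OF finite_grid_index[OF B], symmetric])
  also have "\<dots> = (\<Prod>x\<in>T \<inter> B. a x)"
    by (rule prod.reindex_bij_betw[OF elim])
  finally show ?case .
qed

section \<open>Probability generating functions\<close>

lemma abs_prod_le_1:
  fixes a :: "'a \<Rightarrow> real"
  assumes "\<And>x. x \<in> A \<Longrightarrow> \<bar>a x\<bar> \<le> 1"
  shows "\<bar>\<Prod>x\<in>A. a x\<bar> \<le> 1"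
  unfolding abs_prod using assms by (intro prod_le_1) auto

text \<open>
  By induction on the degree: once the lower coefficients agree, the difference series divided
  by \<open>s ^ n\<close> vanishes near \<open>0\<close>, and its limit at \<open>0\<close> is the difference of the coefficients of degree \<open>n\<close>.
\<close>

lemma powser_coeff_unique:
  fixes a b :: "nat \<Rightarrow> real"
  assumes a: "\<And>s. \<bar>s\<bar> \<le> 1 \<Longrightarrow> (\<lambda>k. a k * s ^ k) sums F s"
    and b: "\<And>s. \<bar>s\<bar> \<le> 1 \<Longrightarrow> (\<lambda>k. b k * s ^ k) sums F s"
  shows "a k = b k"
proof -
  define d where "d k = a k - b k" for k
  have d: "(\<lambda>k. d k * s ^ k) sums 0" if "\<bar>s\<bar> \<le> 1" for s
    using sums_diff[OF a b, OF that that] by (simp add: d_def algebra_simps)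
  have "d k = 0"
  proof (induction k rule: less_induct)
    case (less n)
    have "(\<lambda>k. d (k + n) * s ^ k) sums 0" if "s \<noteq> 0" "norm s < 1" for s
    proof -
      have "(\<lambda>k. d (k + n) * s ^ (k + n)) sums (0 - (\<Sum>i<n. d i * s ^ i))"
        using d[of s] that by (intro sums_iff_shift[THEN iffD2]) auto
      then have "(\<lambda>k. (1 / s ^ n) * (d (k + n) * s ^ (k + n))) sums ((1 / s ^ n) * 0)"
        using less.IH by (intro sums_mult) simp
      then show ?thesis
        using that by (simp add: power_add)
    qed
    then have "((\<lambda>s. 0) \<longlongrightarrow> d (0 + n)) (at (0::real))"
      by (intro powser_limit_0_strong[where s = 1]) auto
    then show "d n = 0"
      by (simp add: tendsto_const_iff)
  qed
  then show ?thesis by (simp add: d_def)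
qed

text \<open>
  The weight \<open>Y\<close> lets one treat the arguments of a joint generating function one at a time: all
  the other factors are absorbed into \<open>Y\<close>.
\<close>

lemma (in prob_space) weighted_pgf_sums:
  fixes X :: "'a \<Rightarrow> nat" and Y :: "'a \<Rightarrow> real"
  assumes X [measurable]: "X \<in> measurable M (count_space UNIV)"
    and Y [measurable]: "Y \<in> borel_measurable M"
    and C: "\<And>\<omega>. \<omega> \<in> space M \<Longrightarrow> \<bar>Y \<omega>\<bar> \<le> C"
    and s: "\<bar>s\<bar> \<le> 1"
  shows "(\<lambda>k. (\<integral>\<omega>. Y \<omega> * of_bool (X \<omega> = k) \<partial>M) * s ^ k) sums (\<integral>\<omega>. Y \<omega> * s ^ X \<omega> \<partial>M)"
proof -
  have bound: "\<bar>Y \<omega> * s ^ X \<omega>\<bar> \<le> C" if "\<omega> \<in> space M" for \<omega>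
  proof -
    have "\<bar>Y \<omega>\<bar> * \<bar>s\<bar> ^ X \<omega> \<le> C * 1"
      using C[OF that] s by (intro mult_mono) (auto intro: power_le_one)
    then show ?thesis by (simp add: abs_mult power_abs)
  qed
  have "C \<ge> 0" using C not_empty by fastforce
  have int: "integrable M (\<lambda>\<omega>. Y \<omega> * of_bool (X \<omega> = k))" for k
    using C \<open>C \<ge> 0\<close> by (intro integrable_const_bound[where B = C]) (auto intro!: AE_I2)
  have "(\<lambda>n. \<integral>\<omega>. Y \<omega> * s ^ X \<omega> * of_bool (X \<omega> < n) \<partial>M) \<longlonglongrightarrow> (\<integral>\<omega>. Y \<omega> * s ^ X \<omega> \<partial>M)"
  proof (rule integral_dominated_convergence[where w = "\<lambda>_. C"])
    show "AE \<omega> in M. (\<lambda>n. Y \<omega> * s ^ X \<omega> * of_bool (X \<omega> < n)) \<longlonglongrightarrow> Y \<omega> * s ^ X \<omega>"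
    proof (intro AE_I2 tendsto_eventually)
      fix \<omega> show "eventually (\<lambda>n. Y \<omega> * s ^ X \<omega> * of_bool (X \<omega> < n) = Y \<omega> * s ^ X \<omega>) sequentially"
        using eventually_gt_at_top[of "X \<omega>"] by eventually_elim simp
    qed
    show "AE \<omega> in M. norm (Y \<omega> * s ^ X \<omega> * of_bool (X \<omega> < n)) \<le> C" for n
      using bound \<open>C \<ge> 0\<close> by (intro AE_I2) (auto simp: of_bool_def)
  qed simp_all
  moreover have "(\<integral>\<omega>. Y \<omega> * s ^ X \<omega> * of_bool (X \<omega> < n) \<partial>M)
      = (\<Sum>k<n. (\<integral>\<omega>. Y \<omega> * of_bool (X \<omega> = k) \<partial>M) * s ^ k)" for n
  proof -
    have "Y \<omega> * s ^ X \<omega> * of_bool (X \<omega> < n) = (\<Sum>k<n. Y \<omega> * of_bool (X \<omega> = k) * s ^ k)" for \<omega>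
    proof -
      have "(\<Sum>k<n. Y \<omega> * of_bool (X \<omega> = k) * s ^ k) = (\<Sum>k<n. if X \<omega> = k then Y \<omega> * s ^ k else 0)"
        by (intro sum.cong) auto
      then show ?thesis by simp
    qed
    then show ?thesis
      using int by (simp add: Bochner_Integration.integral_sum)
  qed
  ultimately show ?thesis
    unfolding sums_def by simp
qed

lemma poisson_pgf_sums:
  fixes lam :: real
  shows "(\<lambda>k. lam ^ k / fact k * exp (- lam) * s ^ k) sums exp (- ((1 - s) * lam))"
proof -
  have "(\<lambda>k. exp (- lam) * ((lam * s) ^ k /\<^sub>R fact k)) sums (exp (- lam) * exp (lam * s))"
    by (intro sums_mult exp_converges)
  then show ?thesis
    by (simp add: power_mult_distrib field_simps flip: exp_add)
qed

text \<open>
  The factors \<open>s i ^ X i\<close> of the joint generating function are replaced one after the other by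
  the indicators of \<open>X i = k i\<close>. Each replacement compares coefficients of power series in one
  variable \<open>s j\<close>, the other factors being a bounded weight.
\<close>

lemma (in prob_space) poisson_joint_pmf_of_joint_pgf:
  fixes X :: "'i \<Rightarrow> 'a \<Rightarrow> nat"
  assumes I: "finite I"
    and X: "\<And>i. i \<in> I \<Longrightarrow> X i \<in> measurable M (count_space UNIV)"
    and pgf: "\<And>s. (\<And>i. i \<in> I \<Longrightarrow> \<bar>s i\<bar> \<le> 1) \<Longrightarrow>
      (\<integral>\<omega>. (\<Prod>i\<in>I. s i ^ X i \<omega>) \<partial>M) = (\<Prod>i\<in>I. exp (- ((1 - s i) * lam i)))"
  shows "prob {\<omega>\<in>space M. \<forall>i\<in>I. X i \<omega> = k i} = (\<Prod>i\<in>I. lam i ^ k i / fact (k i) * exp (- lam i))"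
proof -
  \<comment> \<open>Indicators for the indices in \<open>J\<close>, powers for the remaining ones.\<close>
  have partial: "(\<integral>\<omega>. (\<Prod>i\<in>J. of_bool (X i \<omega> = k i)) * (\<Prod>i\<in>I - J. s i ^ X i \<omega>) \<partial>M)
      = (\<Prod>i\<in>J. lam i ^ k i / fact (k i) * exp (- lam i)) * (\<Prod>i\<in>I - J. exp (- ((1 - s i) * lam i)))"
    if "J \<subseteq> I" "\<And>i. i \<in> I \<Longrightarrow> \<bar>s i\<bar> \<le> 1" for J s
    using finite_subset[OF that(1) I] that
  proof (induction J arbitrary: s rule: finite_induct)
    case empty
    then show ?case using pgf by simp
  next
    case (insert j J)
    then have j: "j \<in> I" "j \<notin> J" "finite J" "J \<subseteq> I"
      by auto
    define Y where "Y \<omega> = (\<Prod>i\<in>J. of_bool (X i \<omega> = k i)) * (\<Prod>i\<in>I - insert j J. s i ^ X i \<omega>)" for \<omega>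
    define c where "c = (\<Prod>i\<in>J. lam i ^ k i / fact (k i) * exp (- lam i))
        * (\<Prod>i\<in>I - insert j J. exp (- ((1 - s i) * lam i)))"
    have Y_meas: "Y \<in> borel_measurable M"
      unfolding Y_def
    proof (intro borel_measurable_times borel_measurable_prod)
      fix i assume "i \<in> J"
      then have [measurable]: "X i \<in> measurable M (count_space UNIV)"
        using j X by auto
      show "(\<lambda>\<omega>. of_bool (X i \<omega> = k i)) \<in> borel_measurable M"
        by measurable
    next
      fix i assume "i \<in> I - insert j J"
      then have [measurable]: "X i \<in> measurable M (count_space UNIV)"
        using X by auto
      show "(\<lambda>\<omega>. s i ^ X i \<omega>) \<in> borel_measurable M"
        by measurable
    qed
    have Y_le: "\<bar>Y \<omega>\<bar> \<le> 1" for \<omega>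
    proof -
      have "\<bar>\<Prod>i\<in>J. of_bool (X i \<omega> = k i) :: real\<bar> \<le> 1"
        by (rule abs_prod_le_1) simp
      moreover have "\<bar>\<Prod>i\<in>I - insert j J. s i ^ X i \<omega>\<bar> \<le> 1"
        using insert.prems(2) by (intro abs_prod_le_1) (auto simp: power_abs power_le_one)
      ultimately have "\<bar>\<Prod>i\<in>J. of_bool (X i \<omega> = k i) :: real\<bar> * \<bar>\<Prod>i\<in>I - insert j J. s i ^ X i \<omega>\<bar> \<le> 1 * 1"
        by (intro mult_mono) auto
      then show ?thesis by (simp add: Y_def abs_mult)
    qed
    have rest: "I - J = insert j (I - insert j J)" "j \<notin> I - insert j J" "finite (I - insert j J)"
      using j I by auto
    have step: "(\<integral>\<omega>. Y \<omega> * r ^ X j \<omega> \<partial>M) = c * exp (- ((1 - r) * lam j))" if r: "\<bar>r\<bar> \<le> 1" for r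
    proof -
      have eq: "(\<Prod>i\<in>I - J. F i ((s(j := r)) i)) = F j r * (\<Prod>i\<in>I - insert j J. F i (s i))"
        for F :: "'i \<Rightarrow> real \<Rightarrow> real"
      proof -
        have "(\<Prod>i\<in>I - J. F i ((s(j := r)) i)) = F j r * (\<Prod>i\<in>I - insert j J. F i ((s(j := r)) i))"
          unfolding rest(1) by (subst prod.insert[OF rest(3,2)]) simp
        also have "(\<Prod>i\<in>I - insert j J. F i ((s(j := r)) i)) = (\<Prod>i\<in>I - insert j J. F i (s i))"
          by (intro prod.cong) auto
        finally show ?thesis .
      qed
      have "(\<integral>\<omega>. (\<Prod>i\<in>J. of_bool (X i \<omega> = k i)) * (\<Prod>i\<in>I - J. (s(j := r)) i ^ X i \<omega>) \<partial>M)
        = (\<Prod>i\<in>J. lam i ^ k i / fact (k i) * exp (- lam i))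
          * (\<Prod>i\<in>I - J. exp (- ((1 - (s(j := r)) i) * lam i)))"
        using insert.prems(2) r j by (intro insert.IH) auto
      then show ?thesis
        unfolding eq[of "\<lambda>i t. exp (- ((1 - t) * lam i))"] eq[of "\<lambda>i t. t ^ X i _"]
        by (simp add: Y_def c_def mult_ac)
    qed
    have "(\<integral>\<omega>. Y \<omega> * of_bool (X j \<omega> = k j) \<partial>M) = c * (lam j ^ k j / fact (k j) * exp (- lam j))"
    proof (rule powser_coeff_unique)
      fix r :: real assume r: "\<bar>r\<bar> \<le> 1"
      show "(\<lambda>k. (\<integral>\<omega>. Y \<omega> * of_bool (X j \<omega> = k) \<partial>M) * r ^ k) sums (\<integral>\<omega>. Y \<omega> * r ^ X j \<omega> \<partial>M)"
        using X[OF j(1)] Y_meas Y_le r by (rule weighted_pgf_sums)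
      show "(\<lambda>k. c * (lam j ^ k / fact k * exp (- lam j)) * r ^ k) sums (\<integral>\<omega>. Y \<omega> * r ^ X j \<omega> \<partial>M)"
        unfolding step[OF r] mult.assoc[of c] by (intro sums_mult poisson_pgf_sums)
    qed
    then show ?case
      using j by (simp add: Y_def c_def mult_ac)
  qed
  have sets: "{\<omega>\<in>space M. \<forall>i\<in>I. X i \<omega> = k i} \<in> events"
    using I X by (intro sets.sets_Collect_finite_All) auto
  have "(\<Prod>i\<in>I. lam i ^ k i / fact (k i) * exp (- lam i))
      = (\<integral>\<omega>. (\<Prod>i\<in>I. of_bool (X i \<omega> = k i)) \<partial>M)"
    using partial[of I "\<lambda>_. 1"] by simp
  also have "\<dots> = (\<integral>\<omega>. indicator {\<omega>\<in>space M. \<forall>i\<in>I. X i \<omega> = k i} \<omega> \<partial>M)"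
  proof (intro Bochner_Integration.integral_cong refl)
    fix \<omega> assume "\<omega> \<in> space M"
    then show "(\<Prod>i\<in>I. of_bool (X i \<omega> = k i)) = indicat_real {\<omega>\<in>space M. \<forall>i\<in>I. X i \<omega> = k i} \<omega>"
      using I by (auto simp: indicator_def prod_zero_iff)
  qed
  also have "\<dots> = prob {\<omega>\<in>space M. \<forall>i\<in>I. X i \<omega> = k i}"
    using sets by (simp add: Int_absorb2 Collect_restrict)
  finally show ?thesis ..
qed

text \<open>
  The joint distribution and the product of the marginals live on a countable space, where
  equality of measures is equality on singletons.
\<close>

lemma (in prob_space) indep_vars_countableI:
  fixes X :: "'i \<Rightarrow> 'a \<Rightarrow> 'b::countable"
  assumes I: "finite I" "I \<noteq> {}"
    and X: "\<And>i. i \<in> I \<Longrightarrow> X i \<in> measurable M (count_space UNIV)"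
    and prod: "\<And>k. prob {\<omega>\<in>space M. \<forall>i\<in>I. X i \<omega> = k i} = (\<Prod>i\<in>I. prob {\<omega>\<in>space M. X i \<omega> = k i})"
  shows "indep_vars (\<lambda>_. count_space UNIV) X I"
proof (subst indep_vars_iff_distr_eq_PiM'[OF I(2) X])
  have ps: "prob_space (distr M (count_space UNIV) (if i \<in> I then X i else (\<lambda>_. undefined)))" for i
    using X by (intro prob_space_distr) auto
  let ?D = "\<lambda>i. distr M (count_space UNIV) (if i \<in> I then X i else (\<lambda>_. undefined))"
  interpret pps: product_prob_space ?D I
    by (intro product_prob_spaceI ps)
  have D: "PiM I (\<lambda>i. distr M (count_space UNIV) (X i)) = PiM I ?D"
    by (intro PiM_cong) auto
  have count: "PiM I (\<lambda>_. count_space (UNIV :: 'b set)) = count_space (I \<rightarrow>\<^sub>E UNIV)"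
    using I by (intro count_space_PiM_finite) auto
  have Xm: "(\<lambda>\<omega>. \<lambda>i\<in>I. X i \<omega>) \<in> measurable M (PiM I (\<lambda>_. count_space UNIV))"
    using X by (intro measurable_restrict)
  show "distr M (PiM I (\<lambda>_. count_space UNIV)) (\<lambda>\<omega>. \<lambda>i\<in>I. X i \<omega>)
      = PiM I (\<lambda>i. distr M (count_space UNIV) (X i))"
  proof (rule measure_eqI_countable[where A = "I \<rightarrow>\<^sub>E UNIV"])
    show "sets (distr M (PiM I (\<lambda>_. count_space UNIV)) (\<lambda>\<omega>. \<lambda>i\<in>I. X i \<omega>)) = Pow (I \<rightarrow>\<^sub>E UNIV)"
      unfolding count by simp
    have "sets (PiM I (\<lambda>i. distr M (count_space UNIV) (X i))) = sets (PiM I (\<lambda>_. count_space (UNIV :: 'b set)))"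
      by (intro sets_PiM_cong) auto
    then show "sets (PiM I (\<lambda>i. distr M (count_space UNIV) (X i))) = Pow (I \<rightarrow>\<^sub>E UNIV)"
      unfolding count by simp
    show "countable (I \<rightarrow>\<^sub>E (UNIV :: 'b set))"
      using I by (intro countable_PiE) auto
    fix k :: "'i \<Rightarrow> 'b" assume k: "k \<in> I \<rightarrow>\<^sub>E UNIV"
    have sing: "{k} = (\<Pi>\<^sub>E i\<in>I. {k i})"
      using k by (simp add: PiE_singleton PiE_iff)
    have "emeasure (PiM I (\<lambda>i. distr M (count_space UNIV) (X i))) {k} = (\<Prod>i\<in>I. emeasure (?D i) {k i})"
      unfolding D sing using I by (intro pps.emeasure_PiM) auto
    also have "\<dots> = (\<Prod>i\<in>I. ennreal (prob {\<omega>\<in>space M. X i \<omega> = k i}))"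
    proof (intro prod.cong refl)
      fix i assume i: "i \<in> I"
      have "emeasure (?D i) {k i} = emeasure M (X i -` {k i} \<inter> space M)"
        using i X by (simp add: emeasure_distr)
      also have "X i -` {k i} \<inter> space M = {\<omega>\<in>space M. X i \<omega> = k i}"
        by auto
      finally show "emeasure (?D i) {k i} = ennreal (prob {\<omega>\<in>space M. X i \<omega> = k i})"
        by (simp add: emeasure_eq_measure)
    qed
    also have "\<dots> = ennreal (prob {\<omega>\<in>space M. \<forall>i\<in>I. X i \<omega> = k i})"
      unfolding prod by (simp add: prod_ennreal)
    also have "\<dots> = emeasure M ((\<lambda>\<omega>. \<lambda>i\<in>I. X i \<omega>) -` {k} \<inter> space M)"
    proof -
      have "(\<lambda>\<omega>. \<lambda>i\<in>I. X i \<omega>) -` {k} \<inter> space M = {\<omega>\<in>space M. \<forall>i\<in>I. X i \<omega> = k i}"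
        unfolding sing by auto
      then show ?thesis by (simp add: emeasure_eq_measure)
    qed
    also have "\<dots> = emeasure (distr M (PiM I (\<lambda>_. count_space UNIV)) (\<lambda>\<omega>. \<lambda>i\<in>I. X i \<omega>)) {k}"
      using Xm k by (subst emeasure_distr) (simp_all add: count)
    finally show "emeasure (distr M (PiM I (\<lambda>_. count_space UNIV)) (\<lambda>\<omega>. \<lambda>i\<in>I. X i \<omega>)) {k}
        = emeasure (PiM I (\<lambda>i. distr M (count_space UNIV) (X i))) {k}" ..
  qed
qed

section \<open>The generating functional of a Poisson process\<close>

lemma poisson_process_prob_space: "poisson_process M f N \<Longrightarrow> prob_space M"
  by (simp add: poisson_process_def)

lemma poisson_process_measurable: "poisson_process M f N \<Longrightarrow> N \<in> measurable M config_space"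
  by (simp add: poisson_process_def)

lemma poisson_process_pgf:
  assumes P: "poisson_process M f N" and B: "B \<in> sets borel" "bounded B" and s: "\<bar>s\<bar> \<le> 1"
  shows "(\<integral>\<omega>. s ^ card (N \<omega> \<inter> B) \<partial>M) = exp (- ((1 - s) * (LINT x:B|lborel. f x)))"
proof -
  interpret prob_space M
    using P by (rule poisson_process_prob_space)
  note N = poisson_process_measurable[OF P]
  note [measurable] = measurable_count[OF N B]
  have "(\<integral>\<omega>. (1::real) * of_bool (card (N \<omega> \<inter> B) = k) \<partial>M)
      = (LINT x:B|lborel. f x) ^ k / fact k * exp (- (LINT x:B|lborel. f x))" for k
  proof -
    have "(\<integral>\<omega>. (1::real) * of_bool (card (N \<omega> \<inter> B) = k) \<partial>M)
        = (\<integral>\<omega>. indicator {\<omega> \<in> space M. card (N \<omega> \<inter> B) = k} \<omega> \<partial>M)"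
      by (intro Bochner_Integration.integral_cong) (auto simp: indicator_def)
    also have "\<dots> = measure M {\<omega> \<in> space M. card (N \<omega> \<inter> B) = k}"
      by (simp add: Int_absorb2 Collect_restrict)
    finally show ?thesis
      using P B unfolding poisson_process_def by auto
  qed
  then have "(\<lambda>k. (LINT x:B|lborel. f x) ^ k / fact k * exp (- (LINT x:B|lborel. f x)) * s ^ k)
      sums (\<integral>\<omega>. 1 * s ^ card (N \<omega> \<inter> B) \<partial>M)"
    using weighted_pgf_sums[of "\<lambda>\<omega>. card (N \<omega> \<inter> B)" "\<lambda>_. 1" 1 s] s by simp
  from sums_unique2[OF this poisson_pgf_sums] show ?thesis by simp
qed

text \<open>
  The counts are independent, so the expectation factorizes. This is the generating functional
  of functions that take finitely many values.
\<close>

lemma poisson_process_joint_pgf: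
  fixes n :: nat
  assumes P: "poisson_process M f N"
    and B: "\<And>i. i < n \<Longrightarrow> B i \<in> sets borel" "\<And>i. i < n \<Longrightarrow> bounded (B i)"
    and disj: "disjoint_family_on B {..<n}"
    and s: "\<And>i. i < n \<Longrightarrow> \<bar>s i\<bar> \<le> 1"
  shows "(\<integral>\<omega>. (\<Prod>i<n. s i ^ card (N \<omega> \<inter> B i)) \<partial>M)
    = exp (- (\<Sum>i<n. (1 - s i) * (LINT x:B i|lborel. f x)))"
proof -
  interpret prob_space M
    using P by (rule poisson_process_prob_space)
  note N = poisson_process_measurable[OF P]
  have "indep_vars (\<lambda>_. count_space UNIV) (\<lambda>i \<omega>. card (N \<omega> \<inter> B i)) {..<n}"
    using P B disj by (simp add: poisson_process_def)
  then have ind: "indep_vars (\<lambda>_. borel) (\<lambda>i \<omega>. s i ^ card (N \<omega> \<inter> B i)) {..<n}"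
    by (rule indep_vars_compose2) simp
  have "integrable M (\<lambda>\<omega>. s i ^ card (N \<omega> \<inter> B i))" if "i < n" for i
  proof (rule integrable_const_bound[where B = 1])
    show "AE \<omega> in M. norm (s i ^ card (N \<omega> \<inter> B i)) \<le> 1"
      using s[OF that] by (simp add: power_abs power_le_one)
    show "(\<lambda>\<omega>. s i ^ card (N \<omega> \<inter> B i)) \<in> borel_measurable M"
      by (rule measurable_compose[OF measurable_count[OF N B[OF that]]]) simp_all
  qed
  then have "(\<integral>\<omega>. (\<Prod>i<n. s i ^ card (N \<omega> \<inter> B i)) \<partial>M)
      = (\<Prod>i<n. \<integral>\<omega>. s i ^ card (N \<omega> \<inter> B i) \<partial>M)"
    by (intro indep_vars_lebesgue_integral[OF _ ind]) simp_all
  also have "\<dots> = (\<Prod>i<n. exp (- ((1 - s i) * (LINT x:B i|lborel. f x))))"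
    using B s by (intro prod.cong refl poisson_process_pgf[OF P]) auto
  finally show ?thesis
    by (simp add: exp_sum flip: sum_negf)
qed

text \<open>
  The function \<open>\<phi>\<close> is rounded down to multiples of \<open>1 / m\<close>. The rounded function takes finitely many
  values, so that the product over points becomes a product of powers of counts in its level
  sets; dominated convergence handles both sides as \<open>m\<close> grows.
\<close>

lemma poisson_process_pgfl:
  fixes N :: "'w \<Rightarrow> 'a::euclidean_space set" and \<phi> :: "'a \<Rightarrow> real"
  assumes P: "poisson_process M f N"
    and B: "B \<in> sets borel" "bounded B"
    and \<phi> [measurable]: "\<phi> \<in> borel_measurable borel"
    and range: "\<And>x. 0 \<le> \<phi> x" "\<And>x. \<phi> x \<le> 2"
  shows "(\<lambda>\<omega>. \<Prod>x\<in>N \<omega> \<inter> B. (1 - \<phi> x)) \<in> borel_measurable M"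
    and "(\<integral>\<omega>. (\<Prod>x\<in>N \<omega> \<inter> B. (1 - \<phi> x)) \<partial>M) = exp (- (LINT x:B|lborel. f x * \<phi> x))"
proof -
  interpret prob_space M
    using P by (rule poisson_process_prob_space)
  note N = poisson_process_measurable[OF P]
  have f [measurable]: "f \<in> borel_measurable borel" and f_int: "set_integrable lborel B f"
    using P B by (simp_all add: poisson_process_def)
  \<comment> \<open>For \<open>m > 0\<close>, \<open>psi m\<close> is \<open>\<phi>\<close> rounded down to a multiple of \<open>1 / m\<close>, and \<open>L m k\<close> the part of \<open>B\<close> where it equals \<open>k / m\<close>.\<close>
  define lev where "lev m x = nat \<lfloor>real m * \<phi> x\<rfloor>" for m x
  define psi where "psi m x = real (lev m x) / real m" for m x
  define L where "L m k = {x\<in>B. lev m x = k}" for m k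
  have lev_le: "lev m x < 2 * m + 1" for m x
  proof -
    have "real m * \<phi> x \<le> real (2 * m)"
      using mult_left_mono[OF range(2)[of x], of "real m"] by simp
    then have "\<lfloor>real m * \<phi> x\<rfloor> \<le> int (2 * m)"
      by (simp add: floor_le_iff)
    then show ?thesis
      unfolding lev_def by linarith
  qed
  have psi_range: "0 \<le> psi m x \<and> psi m x \<le> 2" if "m > 0" for m x
    using lev_le[of m x] that by (auto simp: psi_def field_simps)
  have psi_close: "\<bar>psi m x - \<phi> x\<bar> \<le> 1 / real m" if "m > 0" for m x
  proof -
    have "\<bar>real (lev m x) - real m * \<phi> x\<bar> \<le> 1"
      unfolding lev_def using range(1)[of x] by (simp add: abs_le_iff) linarith
    moreover have "psi m x - \<phi> x = (real (lev m x) - real m * \<phi> x) / real m"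
      using that by (simp add: psi_def field_simps)
    ultimately show ?thesis
      using that by (simp add: divide_right_mono)
  qed
  have psi_lim: "(\<lambda>j. psi (Suc j) x) \<longlonglongrightarrow> \<phi> x" for x
  proof -
    have "(\<lambda>j. psi (Suc j) x - \<phi> x) \<longlonglongrightarrow> 0"
    proof (rule Lim_null_comparison)
      show "eventually (\<lambda>j. norm (psi (Suc j) x - \<phi> x) \<le> 1 / real (Suc j)) sequentially"
        by (intro always_eventually allI) (simp only: real_norm_def psi_close zero_less_Suc)
      show "(\<lambda>j. 1 / real (Suc j)) \<longlonglongrightarrow> 0"
        using lim_inverse_n' LIMSEQ_Suc by blast
    qed
    then show ?thesis by (simp add: LIM_zero_iff)
  qed
  have lev_meas [measurable]: "lev m \<in> measurable borel (count_space UNIV)" for m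
    unfolding lev_def by measurable
  have psi_meas [measurable]: "psi m \<in> borel_measurable borel" for m
    unfolding psi_def by measurable
  have L: "L m k \<in> sets borel" "bounded (L m k)" for m k
  proof -
    have "L m k = B \<inter> lev m -` {k}"
      by (auto simp: L_def)
    also have "\<dots> \<in> sets borel"
      using measurable_sets[OF lev_meas[of m], of "{k}"] B by auto
    finally show "L m k \<in> sets borel" .
    show "bounded (L m k)"
      using B(2) by (rule bounded_subset) (auto simp: L_def)
  qed
  have fin: "finite (N \<omega> \<inter> B)" if "\<omega> \<in> space M" for \<omega>
    using locally_finite_set_config[OF N that] B(2) by (rule locally_finite_setD)
  have step: "(\<Prod>x\<in>N \<omega> \<inter> B. (1 - psi m x))
      = (\<Prod>k<2 * m + 1. (1 - real k / real m) ^ card (N \<omega> \<inter> L m k))" if "\<omega> \<in> space M" for \<omega> m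
  proof -
    have "(\<Prod>x\<in>N \<omega> \<inter> B. (1 - psi m x))
        = (\<Prod>k<2 * m + 1. \<Prod>x\<in>{x \<in> N \<omega> \<inter> B. lev m x = k}. (1 - psi m x))"
      using fin[OF that] lev_le by (intro prod.group[symmetric]) auto
    also have "\<dots> = (\<Prod>k<2 * m + 1. (1 - real k / real m) ^ card (N \<omega> \<inter> L m k))"
    proof (rule prod.cong)
      fix k
      have "{x \<in> N \<omega> \<inter> B. lev m x = k} = N \<omega> \<inter> L m k"
        by (auto simp: L_def)
      moreover have "(\<Prod>x\<in>N \<omega> \<inter> L m k. (1 - psi m x)) = (\<Prod>x\<in>N \<omega> \<inter> L m k. (1 - real k / real m))"
        by (intro prod.cong) (auto simp: L_def psi_def)
      ultimately show "(\<Prod>x\<in>{x \<in> N \<omega> \<inter> B. lev m x = k}. (1 - psi m x))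
          = (1 - real k / real m) ^ card (N \<omega> \<inter> L m k)"
        by simp
    qed simp
    finally show ?thesis .
  qed
  have step_meas: "(\<lambda>\<omega>. \<Prod>x\<in>N \<omega> \<inter> B. (1 - psi m x)) \<in> borel_measurable M" for m
  proof -
    have [measurable]: "(\<lambda>\<omega>. card (N \<omega> \<inter> L m k)) \<in> measurable M (count_space UNIV)" for k
      by (rule measurable_count[OF N L])
    have "(\<lambda>\<omega>. \<Prod>k<2 * m + 1. (1 - real k / real m) ^ card (N \<omega> \<inter> L m k)) \<in> borel_measurable M"
      by measurable
    then show ?thesis
      using step by (simp cong: measurable_cong)
  qed
  have step_int: "(\<integral>\<omega>. (\<Prod>x\<in>N \<omega> \<inter> B. (1 - psi m x)) \<partial>M)
      = exp (- (LINT x:B|lborel. f x * psi m x))" if "m > 0" for m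
  proof -
    have "(\<integral>\<omega>. (\<Prod>x\<in>N \<omega> \<inter> B. (1 - psi m x)) \<partial>M)
        = (\<integral>\<omega>. (\<Prod>k<2 * m + 1. (1 - real k / real m) ^ card (N \<omega> \<inter> L m k)) \<partial>M)"
      by (intro Bochner_Integration.integral_cong refl step)
    also have "\<dots> = exp (- (\<Sum>k<2 * m + 1. (1 - (1 - real k / real m)) * (LINT x:L m k|lborel. f x)))"
    proof (rule poisson_process_joint_pgf[OF P L])
      show "disjoint_family_on (L m) {..<2 * m + 1}"
        by (auto simp: disjoint_family_on_def L_def)
      show "\<bar>1 - real k / real m\<bar> \<le> 1" if "k < 2 * m + 1" for k
        using that \<open>m > 0\<close> by (auto simp: abs_le_iff field_simps)
    qed
    also have "(\<Sum>k<2 * m + 1. (1 - (1 - real k / real m)) * (LINT x:L m k|lborel. f x))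
        = (LINT x:B|lborel. f x * psi m x)"
    proof -
      have int: "set_integrable lborel (L m k) f" for k
        by (rule set_integrable_subset[OF f_int]) (use L in \<open>auto simp: L_def\<close>)
      have "indicator B x *\<^sub>R (f x * psi m x)
          = (\<Sum>k<2 * m + 1. real k / real m * (indicator (L m k) x *\<^sub>R f x))" for x
      proof -
        have "(\<Sum>k<2 * m + 1. real k / real m * (indicator (L m k) x *\<^sub>R f x))
            = (\<Sum>k<2 * m + 1. if k = lev m x then indicator B x *\<^sub>R (f x * psi m x) else 0)"
          by (intro sum.cong) (auto simp: L_def psi_def indicator_def)
        then show ?thesis
          using lev_le[of m x] by simp
      qed
      then show ?thesis
        using int unfolding set_lebesgue_integral_def set_integrable_def
        by (simp only: Bochner_Integration.integral_sum integrable_mult_right integral_mult_right_zero) simp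
    qed
    finally show ?thesis .
  qed
  have prod_lim: "(\<lambda>j. \<Prod>x\<in>N \<omega> \<inter> B. (1 - psi (Suc j) x)) \<longlonglongrightarrow> (\<Prod>x\<in>N \<omega> \<inter> B. (1 - \<phi> x))" for \<omega>
    by (intro tendsto_intros psi_lim)
  show meas: "(\<lambda>\<omega>. \<Prod>x\<in>N \<omega> \<inter> B. (1 - \<phi> x)) \<in> borel_measurable M"
    by (rule borel_measurable_LIMSEQ_real[OF prod_lim step_meas])
  have "(\<lambda>j. \<integral>\<omega>. (\<Prod>x\<in>N \<omega> \<inter> B. (1 - psi (Suc j) x)) \<partial>M) \<longlonglongrightarrow> (\<integral>\<omega>. (\<Prod>x\<in>N \<omega> \<inter> B. (1 - \<phi> x)) \<partial>M)"
  proof (rule integral_dominated_convergence[where w = "\<lambda>_. 1"])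
    show "AE \<omega> in M. norm (\<Prod>x\<in>N \<omega> \<inter> B. (1 - psi (Suc j) x)) \<le> 1" for j
    proof (intro AE_I2)
      fix \<omega>
      have "\<bar>1 - psi (Suc j) x\<bar> \<le> 1" for x
        using psi_range[of "Suc j" x] by (auto simp: abs_le_iff)
      then show "norm (\<Prod>x\<in>N \<omega> \<inter> B. (1 - psi (Suc j) x)) \<le> 1"
        unfolding real_norm_def by (rule abs_prod_le_1)
    qed
  qed (use meas step_meas prod_lim in simp_all)
  moreover have "(\<lambda>j. exp (- (LINT x:B|lborel. f x * psi (Suc j) x)))
      \<longlonglongrightarrow> exp (- (LINT x:B|lborel. f x * \<phi> x))"
    unfolding set_lebesgue_integral_def
  proof (intro tendsto_intros integral_dominated_convergence[where w = "\<lambda>x. 2 * (indicator B x *\<^sub>R \<bar>f x\<bar>)"])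
    show "integrable lborel (\<lambda>x. 2 * (indicator B x *\<^sub>R \<bar>f x\<bar>))"
      using set_integrable_abs[OF f_int] by (simp add: set_integrable_def)
    show "AE x in lborel. norm (indicator B x *\<^sub>R (f x * psi (Suc j) x)) \<le> 2 * (indicator B x *\<^sub>R \<bar>f x\<bar>)" for j
    proof (rule AE_I2)
      fix x
      have "\<bar>f x\<bar> * \<bar>psi (Suc j) x\<bar> \<le> \<bar>f x\<bar> * 2"
        using psi_range[of "Suc j" x] by (intro mult_left_mono) auto
      then show "norm (indicator B x *\<^sub>R (f x * psi (Suc j) x)) \<le> 2 * (indicator B x *\<^sub>R \<bar>f x\<bar>)"
        by (simp add: abs_mult indicator_def)
    qed
    show "AE x in lborel. (\<lambda>j. indicator B x *\<^sub>R (f x * psi (Suc j) x)) \<longlonglongrightarrow> indicator B x *\<^sub>R (f x * \<phi> x)"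
      by (intro AE_I2 tendsto_intros psi_lim)
  qed (use B in simp_all)
  ultimately show "(\<integral>\<omega>. (\<Prod>x\<in>N \<omega> \<inter> B. (1 - \<phi> x)) \<partial>M) = exp (- (LINT x:B|lborel. f x * \<phi> x))"
    using step_int by (simp add: LIMSEQ_unique)
qed

section \<open>Independent thinning\<close>

text \<open>
  Independent thinning with retention probability \<open>h\<close>: for finitely many distinct points \<open>u i\<close> of \<open>U\<close>
  chosen as functions of the information \<open>F\<close>, the conditional probability given \<open>F\<close> that all are retained
  is the product of the \<open>h (u i)\<close>. The condition is stated in integrated form, against bounded
  \<open>F\<close>-measurable weights \<open>W\<close>, because this is how it enters the computation of expectations. The
  choice has to be one of distinct points of \<open>U\<close> only on an event \<open>A\<close> in \<open>F\<close>.
\<close>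

locale independent_thinning = prob_space M for M :: "'w measure" +
  fixes F :: "'w measure" and h :: "'a::euclidean_space \<Rightarrow> real" and U S :: "'w \<Rightarrow> 'a set"
  assumes subalg: "subalgebra M F"
    and U_measurable: "U \<in> measurable F config_space"
    and h_measurable [measurable]: "h \<in> borel_measurable borel"
    and h_range: "\<And>x. 0 \<le> h x" "\<And>x. h x \<le> 1"
    and S_subset: "\<And>\<omega>. \<omega> \<in> space M \<Longrightarrow> S \<omega> \<subseteq> U \<omega>"
    and retained: "\<And>(n::nat) A u W C.
      A \<in> sets F \<Longrightarrow> (\<And>i. i < n \<Longrightarrow> u i \<in> borel_measurable F) \<Longrightarrow>
      (\<And>\<omega> i. \<omega> \<in> A \<Longrightarrow> i < n \<Longrightarrow> u i \<omega> \<in> U \<omega>) \<Longrightarrow>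
      (\<And>\<omega>. \<omega> \<in> A \<Longrightarrow> inj_on (\<lambda>i. u i \<omega>) {..<n}) \<Longrightarrow>
      W \<in> borel_measurable F \<Longrightarrow> (\<And>\<omega>. \<bar>W \<omega>\<bar> \<le> C) \<Longrightarrow>
      {\<omega>\<in>A. \<forall>i<n. u i \<omega> \<in> S \<omega>} \<in> sets M \<and>
      (\<integral>\<omega>. W \<omega> * indicator {\<omega>\<in>A. \<forall>i<n. u i \<omega> \<in> S \<omega>} \<omega> \<partial>M)
        = (\<integral>\<omega>. W \<omega> * (indicator A \<omega> * (\<Prod>i<n. h (u i \<omega>))) \<partial>M)"
begin

lemma space_F: "space F = space M"
  using subalg by (simp add: subalgebra_def)

lemma U_measurable_M: "U \<in> measurable M config_space"
  using U_measurable subalg by (rule measurable_from_subalg[rotated])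

lemma finite_U: "\<omega> \<in> space M \<Longrightarrow> bounded B \<Longrightarrow> finite (U \<omega> \<inter> B)"
  using locally_finite_set_config[OF U_measurable_M] by (rule locally_finite_setD)

lemma finite_S: "\<omega> \<in> space M \<Longrightarrow> bounded B \<Longrightarrow> finite (S \<omega> \<inter> B)"
  by (rule finite_subset[OF _ finite_U]) (use S_subset in auto)

lemma sole_point_measurable_F:
  assumes "C \<in> sets borel" "bounded C"
  shows "(\<lambda>\<omega>. sole_point C (U \<omega>)) \<in> borel_measurable F"
  by (rule measurable_compose[OF U_measurable measurable_sole_point[OF assms]])

lemma sole_event_F:
  assumes "C \<in> sets borel" "bounded C"
  shows "{\<omega>\<in>space M. card (U \<omega> \<inter> C) = 1} \<in> sets F"
proof -
  have "(\<lambda>\<omega>. card (U \<omega> \<inter> C)) -` {1} \<inter> space F \<in> sets F"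
    by (rule measurable_sets[OF measurable_count[OF U_measurable assms]]) simp
  also have "(\<lambda>\<omega>. card (U \<omega> \<inter> C)) -` {1} \<inter> space F = {\<omega>\<in>space M. card (U \<omega> \<inter> C) = 1}"
    by (auto simp: space_F simp del: One_nat_def)
  finally show ?thesis .
qed

definition sole_retained :: "'a set \<Rightarrow> 'w \<Rightarrow> bool" where
  "sole_retained C \<omega> \<longleftrightarrow> card (U \<omega> \<inter> C) = 1 \<and> sole_point C (U \<omega>) \<in> S \<omega>"

text \<open>
  The retention property for the points alone in their cells. Disjointness of the cells makes
  the chosen points distinct, and \<open>A\<close> is the event that every cell in the family contains exactly
  one point.
\<close>

lemma
  fixes C :: "'i \<Rightarrow> 'a set" and W :: "'w \<Rightarrow> real"
  assumes J: "finite J"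
    and C: "\<And>q. q \<in> J \<Longrightarrow> C q \<in> sets borel" "\<And>q. q \<in> J \<Longrightarrow> bounded (C q)"
    and disj: "disjoint_family_on C J"
    and W: "W \<in> borel_measurable F" "\<And>\<omega>. \<bar>W \<omega>\<bar> \<le> K"
  shows sole_retained_event: "{\<omega>\<in>space M. \<forall>q\<in>J. sole_retained (C q) \<omega>} \<in> sets M"
    and integral_sole_retained:
      "(\<integral>\<omega>. W \<omega> * (\<Prod>q\<in>J. of_bool (sole_retained (C q) \<omega>)) \<partial>M)
        = (\<integral>\<omega>. W \<omega> * (\<Prod>q\<in>J. of_bool (card (U \<omega> \<inter> C q) = 1) * h (sole_point (C q) (U \<omega>))) \<partial>M)"
proof -
  define n where "n = card J"
  obtain e where e: "bij_betw e {..<n} J"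
    using ex_bij_betw_nat_finite[OF J] by (auto simp: n_def atLeast0LessThan)
  then have eJ: "\<And>i. i < n \<Longrightarrow> e i \<in> J" and e_inj: "inj_on e {..<n}" and e_img: "e ` {..<n} = J"
    by (auto simp: bij_betw_def)
  define A where "A = {\<omega>\<in>space M. \<forall>q\<in>J. card (U \<omega> \<inter> C q) = 1}"
  define u where "u i \<omega> = sole_point (C (e i)) (U \<omega>)" for i \<omega>
  have mem: "u i \<omega> \<in> U \<omega> \<inter> C (e i)" if "\<omega> \<in> A" "i < n" for i \<omega>
    unfolding u_def using that eJ by (intro sole_point_mem) (simp add: A_def)
  have A: "A \<in> sets F"
  proof -
    have "{\<omega>\<in>space F. \<forall>q\<in>J. card (U \<omega> \<inter> C q) = 1} \<in> sets F"
      using J C sole_event_F unfolding space_F[symmetric]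
      by (intro sets.sets_Collect_finite_All) auto
    then show ?thesis by (simp only: A_def space_F)
  qed
  have inj: "inj_on (\<lambda>i. u i \<omega>) {..<n}" if "\<omega> \<in> A" for \<omega>
  proof (rule inj_onI)
    fix i j assume ij: "i \<in> {..<n}" "j \<in> {..<n}" "u i \<omega> = u j \<omega>"
    then have "C (e i) \<inter> C (e j) \<noteq> {}"
      using mem[OF that, of i] mem[OF that, of j] by auto
    then have "e i = e j"
      using disj eJ ij by (auto simp: disjoint_family_on_def)
    then show "i = j"
      using e_inj ij by (auto dest: inj_onD)
  qed
  have ret: "{\<omega>\<in>A. \<forall>i<n. u i \<omega> \<in> S \<omega>} \<in> sets M \<and>
      (\<integral>\<omega>. W \<omega> * indicator {\<omega>\<in>A. \<forall>i<n. u i \<omega> \<in> S \<omega>} \<omega> \<partial>M)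
        = (\<integral>\<omega>. W \<omega> * (indicator A \<omega> * (\<Prod>i<n. h (u i \<omega>))) \<partial>M)"
  proof (rule retained[OF A])
    show "u i \<in> borel_measurable F" if "i < n" for i
      unfolding u_def using C eJ[OF that] by (intro sole_point_measurable_F)
    show "u i \<omega> \<in> U \<omega>" if "\<omega> \<in> A" "i < n" for i \<omega>
      using mem[OF that] by simp
  qed (use W inj in auto)
  have all: "(\<forall>i<n. P (e i)) \<longleftrightarrow> (\<forall>q\<in>J. P q)" for P
    unfolding e_img[symmetric] by auto
  have R: "{\<omega>\<in>A. \<forall>i<n. u i \<omega> \<in> S \<omega>} = {\<omega>\<in>space M. \<forall>q\<in>J. sole_retained (C q) \<omega>}"
    unfolding u_def all[of "\<lambda>q. sole_point (C q) (U _) \<in> S _"] A_def sole_retained_def by blast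
  show "{\<omega>\<in>space M. \<forall>q\<in>J. sole_retained (C q) \<omega>} \<in> sets M"
    using ret unfolding R by blast
  have ind: "(\<Prod>q\<in>J. of_bool (P q)) = (of_bool (\<forall>q\<in>J. P q) :: real)" for P
    using J by (auto simp: prod_zero_iff)
  have "(\<integral>\<omega>. W \<omega> * (\<Prod>q\<in>J. of_bool (sole_retained (C q) \<omega>)) \<partial>M)
      = (\<integral>\<omega>. W \<omega> * indicator {\<omega>\<in>A. \<forall>i<n. u i \<omega> \<in> S \<omega>} \<omega> \<partial>M)"
    unfolding R ind by (intro Bochner_Integration.integral_cong refl) (auto simp: indicator_def)
  also have "\<dots> = (\<integral>\<omega>. W \<omega> * (indicator A \<omega> * (\<Prod>i<n. h (u i \<omega>))) \<partial>M)"
    using ret by blast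
  also have "\<dots> = (\<integral>\<omega>. W \<omega> * (\<Prod>q\<in>J. of_bool (card (U \<omega> \<inter> C q) = 1) * h (sole_point (C q) (U \<omega>))) \<partial>M)"
  proof (intro Bochner_Integration.integral_cong refl)
    fix \<omega> assume "\<omega> \<in> space M"
    then have "indicator A \<omega> = (\<Prod>q\<in>J. of_bool (card (U \<omega> \<inter> C q) = 1) :: real)"
      unfolding ind by (simp add: A_def indicator_def)
    moreover have "(\<Prod>i<n. h (u i \<omega>)) = (\<Prod>q\<in>J. h (sole_point (C q) (U \<omega>)))"
      unfolding u_def by (rule prod.reindex_bij_betw[OF e])
    ultimately show "W \<omega> * (indicator A \<omega> * (\<Prod>i<n. h (u i \<omega>)))
        = W \<omega> * (\<Prod>q\<in>J. of_bool (card (U \<omega> \<inter> C q) = 1) * h (sole_point (C q) (U \<omega>)))"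
      by (simp only: prod.distrib)
  qed
  finally show "(\<integral>\<omega>. W \<omega> * (\<Prod>q\<in>J. of_bool (sole_retained (C q) \<omega>)) \<partial>M)
        = (\<integral>\<omega>. W \<omega> * (\<Prod>q\<in>J. of_bool (card (U \<omega> \<inter> C q) = 1) * h (sole_point (C q) (U \<omega>))) \<partial>M)" .
qed

lemma prod_retained_tendsto:
  assumes B: "bounded B" and \<omega>: "\<omega> \<in> space M"
  shows "(\<lambda>m. \<Prod>q\<in>grid_index m ` B. 1 - of_bool (sole_retained (grid_cell B m q) \<omega>)
      * f (sole_point (grid_cell B m q) (U \<omega>))) \<longlonglongrightarrow> (\<Prod>x\<in>S \<omega> \<inter> B. (1 - f x :: real))"
proof (rule tendsto_eventually)
  have "(\<Prod>x\<in>U \<omega> \<inter> B. if x \<in> S \<omega> then 1 - f x else 1) = (\<Prod>x\<in>{x \<in> U \<omega> \<inter> B. x \<in> S \<omega>}. 1 - f x)"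
    by (rule prod.inter_filter[OF finite_U[OF \<omega> B], symmetric])
  also have "{x \<in> U \<omega> \<inter> B. x \<in> S \<omega>} = S \<omega> \<inter> B"
    using S_subset[OF \<omega>] by auto
  finally have eq: "(\<Prod>x\<in>U \<omega> \<inter> B. if x \<in> S \<omega> then 1 - f x else 1) = (\<Prod>x\<in>S \<omega> \<inter> B. 1 - f x)" .
  show "eventually (\<lambda>m. (\<Prod>q\<in>grid_index m ` B. 1 - of_bool (sole_retained (grid_cell B m q) \<omega>)
      * f (sole_point (grid_cell B m q) (U \<omega>))) = (\<Prod>x\<in>S \<omega> \<inter> B. 1 - f x)) sequentially"
    using eventually_prod_grid_eq[OF B finite_U[OF \<omega> B], of "\<lambda>x. if x \<in> S \<omega> then 1 - f x else 1"]
  proof eventually_elim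
    case (elim m)
    show ?case
      unfolding eq[symmetric] elim[symmetric] by (intro prod.cong refl) (simp add: sole_retained_def)
  qed
qed

lemma prod_thinned_tendsto:
  assumes B: "bounded B" and \<omega>: "\<omega> \<in> space M"
  shows "(\<lambda>m. \<Prod>q\<in>grid_index m ` B. 1 - of_bool (card (U \<omega> \<inter> grid_cell B m q) = 1)
      * f (sole_point (grid_cell B m q) (U \<omega>))) \<longlonglongrightarrow> (\<Prod>x\<in>U \<omega> \<inter> B. (1 - f x :: real))"
proof (rule tendsto_eventually)
  show "eventually (\<lambda>m. (\<Prod>q\<in>grid_index m ` B. 1 - of_bool (card (U \<omega> \<inter> grid_cell B m q) = 1)
      * f (sole_point (grid_cell B m q) (U \<omega>))) = (\<Prod>x\<in>U \<omega> \<inter> B. 1 - f x)) sequentially"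
    using eventually_prod_grid_eq[OF B finite_U[OF \<omega> B], of "\<lambda>x. 1 - f x"]
  proof eventually_elim
    case (elim m)
    show ?case
      unfolding elim[symmetric] by (intro prod.cong refl) simp
  qed
qed

lemma measurable_sole_retained:
  assumes "C \<in> sets borel" "bounded C"
  shows "Measurable.pred M (sole_retained C)"
proof -
  have "{\<omega>\<in>space M. \<forall>q\<in>{()}. sole_retained C \<omega>} \<in> sets M"
    using assms by (intro sole_retained_event[where W = "\<lambda>_. 0" and K = 0])
      (auto simp: disjoint_family_on_def)
  then show ?thesis by (simp add: pred_def)
qed

lemma measurable_prod_retained_cells:
  fixes f :: "'a \<Rightarrow> real"
  assumes B: "B \<in> sets borel" "bounded B" and f: "f \<in> borel_measurable borel"
  shows "(\<lambda>\<omega>. \<Prod>q\<in>grid_index m ` B. 1 - of_bool (sole_retained (grid_cell B m q) \<omega>)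
      * f (sole_point (grid_cell B m q) (U \<omega>))) \<in> borel_measurable M"
proof (intro borel_measurable_prod borel_measurable_diff borel_measurable_times borel_measurable_const)
  fix q
  note C = borel_grid_cell[OF B(1), of m q] bounded_grid_cell[OF B(2), of m q]
  note [measurable] = measurable_sole_retained[OF C]
  show "(\<lambda>\<omega>. of_bool (sole_retained (grid_cell B m q) \<omega>)) \<in> borel_measurable M"
    by measurable
  show "(\<lambda>\<omega>. f (sole_point (grid_cell B m q) (U \<omega>))) \<in> borel_measurable M"
    by (rule measurable_compose[OF measurable_from_subalg[OF subalg sole_point_measurable_F[OF C]] f])
qed

lemma measurable_prod_retained:
  assumes B: "B \<in> sets borel" "bounded B" and f: "f \<in> borel_measurable borel"
  shows "(\<lambda>\<omega>. \<Prod>x\<in>S \<omega> \<inter> B. (1 - f x :: real)) \<in> borel_measurable M"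
  by (rule borel_measurable_LIMSEQ_real[OF prod_retained_tendsto[OF B(2)] measurable_prod_retained_cells[OF assms]])

text \<open>
  The count of \<open>S\<close> in \<open>B\<close> is the exponent in \<open>\<Prod>x\<in>S \<inter> B. 2 = 2 ^ card (S \<inter> B)\<close>, a product already known to
  be measurable.
\<close>

lemma S_measurable: "S \<in> measurable M config_space"
proof (rule measurable_config_spaceI)
  show "locally_finite_set (S \<omega>)" if "\<omega> \<in> space M" for \<omega>
    using finite_S[OF that] by (simp add: locally_finite_set_def)
  fix B :: "'a set" assume B: "B \<in> sets borel" "bounded B"
  \<comment> \<open>Writing \<open>2\<close> as \<open>1 - (- 1)\<close> matches the products \<open>1 - f x\<close> with \<open>f = - 1\<close>.\<close>
  have "(\<lambda>\<omega>. \<Prod>x\<in>S \<omega> \<inter> B. (1 - (- 1) :: real)) \<in> borel_measurable M"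
    using B by (rule measurable_prod_retained) simp
  then have [measurable]: "(\<lambda>\<omega>. 2 ^ card (S \<omega> \<inter> B) :: real) \<in> borel_measurable M"
    by simp
  have "(\<lambda>\<omega>. card (S \<omega> \<inter> B)) -` {k} \<inter> space M \<in> sets M" for k
  proof -
    have "{\<omega>\<in>space M. (2::real) ^ card (S \<omega> \<inter> B) = 2 ^ k} \<in> sets M"
      by measurable
    also have "{\<omega>\<in>space M. (2::real) ^ card (S \<omega> \<inter> B) = 2 ^ k}
        = (\<lambda>\<omega>. card (S \<omega> \<inter> B)) -` {k} \<inter> space M"
      by auto
    finally show ?thesis .
  qed
  then show "(\<lambda>\<omega>. card (S \<omega> \<inter> B)) \<in> measurable M (count_space UNIV)"
    by (simp add: measurable_count_space_eq2_countable)
qed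

text \<open>
  Replacing points by grid cells, both products are of the form \<open>\<Prod>q. 1 - a q\<close>, which expands into
  the sum over sets \<open>J\<close> of cells of \<open>(- 1) ^ card J * (\<Prod>q\<in>J. a q)\<close>. Corresponding summands have the same
  expectation by the retention property with weight \<open>\<Prod>q\<in>J. f (u q)\<close>, where \<open>u q\<close> is the point in cell \<open>q\<close>.
\<close>

theorem expectation_prod_retained:
  assumes B: "B \<in> sets borel" "bounded B" and f: "f \<in> borel_measurable borel"
    and f_range: "\<And>x. 0 \<le> f x" "\<And>x. f x \<le> (2 :: real)"
  shows "(\<integral>\<omega>. (\<Prod>x\<in>S \<omega> \<inter> B. (1 - f x)) \<partial>M) = (\<integral>\<omega>. (\<Prod>x\<in>U \<omega> \<inter> B. (1 - f x * h x)) \<partial>M)"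
proof -
  define Q where "Q m = grid_index m ` B" for m
  define p where "p m q \<omega> = sole_point (grid_cell B m q) (U \<omega>)" for m q \<omega>
  define r where "r m q \<omega> = (of_bool (sole_retained (grid_cell B m q) \<omega>) :: real)" for m q \<omega>
  define c where "c m q \<omega> = (of_bool (card (U \<omega> \<inter> grid_cell B m q) = 1) :: real)" for m q \<omega>
  have Q: "finite (Q m)" for m
    unfolding Q_def using B(2) by (rule finite_grid_index)
  have C: "grid_cell B m q \<in> sets borel" "bounded (grid_cell B m q)" for m q
    using B by (auto intro: borel_grid_cell bounded_grid_cell)
  have p_F: "(\<lambda>\<omega>. f (p m q \<omega>)) \<in> borel_measurable F" for m q
    unfolding p_def by (rule measurable_compose[OF sole_point_measurable_F[OF C] f])
  have p_M: "(\<lambda>\<omega>. f (p m q \<omega>)) \<in> borel_measurable M" for m q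
    by (rule measurable_from_subalg[OF subalg p_F])
  have hp_M: "(\<lambda>\<omega>. h (p m q \<omega>)) \<in> borel_measurable M" for m q
    unfolding p_def
    by (rule measurable_from_subalg[OF subalg measurable_compose[OF sole_point_measurable_F[OF C] h_measurable]])
  have r_M: "r m q \<in> borel_measurable M" for m q
  proof -
    note [measurable] = measurable_sole_retained[OF C]
    show ?thesis unfolding r_def by measurable
  qed
  have c_M: "c m q \<in> borel_measurable M" for m q
    unfolding c_def by (rule measurable_compose[OF measurable_count[OF U_measurable_M C]]) simp
  have r_le: "\<bar>r m q \<omega>\<bar> \<le> 1" and c_le: "\<bar>c m q \<omega>\<bar> \<le> 1" for m q \<omega>
    by (simp_all add: r_def c_def)
  have f_abs: "\<bar>f x\<bar> \<le> 2" and h_abs: "\<bar>h x\<bar> \<le> 1" for x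
    using f_range[of x] h_range[of x] by auto
  have bnd: "\<bar>\<Prod>q\<in>J. a q * b q\<bar> \<le> 2 ^ card J"
    if "\<And>q. \<bar>a q\<bar> \<le> 1" "\<And>q. \<bar>b q\<bar> \<le> 2" for J :: "('a \<Rightarrow> int) set" and a b :: "('a \<Rightarrow> int) \<Rightarrow> real"
  proof -
    have "\<bar>a q * b q\<bar> \<le> 1 * 2" for q
      unfolding abs_mult using that by (intro mult_mono) auto
    then have "(\<Prod>q\<in>J. \<bar>a q * b q\<bar>) \<le> (\<Prod>q\<in>J. 2)"
      by (intro prod_mono) auto
    then show ?thesis by (simp add: abs_prod)
  qed
  have fh_abs: "\<bar>f x * h x\<bar> \<le> 2" for x
  proof -
    have "\<bar>f x\<bar> * \<bar>h x\<bar> \<le> 2 * 1"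
      using f_abs h_abs by (intro mult_mono) auto
    then show ?thesis by (simp add: abs_mult)
  qed
  have fh_range: "0 \<le> f x * h x" "f x * h x \<le> 2" for x
    using f_range[of x] h_range[of x] fh_abs[of x] by auto
  \<comment> \<open>The identity holds exactly for every grid; only the passage from cells to points is a limit.\<close>
  have cells: "(\<integral>\<omega>. (\<Prod>q\<in>Q m. 1 - r m q \<omega> * f (p m q \<omega>)) \<partial>M)
      = (\<integral>\<omega>. (\<Prod>q\<in>Q m. 1 - c m q \<omega> * (f (p m q \<omega>) * h (p m q \<omega>))) \<partial>M)" for m
  proof -
    have summand: "(\<integral>\<omega>. (\<Prod>q\<in>J. r m q \<omega> * f (p m q \<omega>)) \<partial>M)
        = (\<integral>\<omega>. (\<Prod>q\<in>J. c m q \<omega> * (f (p m q \<omega>) * h (p m q \<omega>))) \<partial>M)" if "J \<subseteq> Q m" for J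
    proof -
      have "(\<integral>\<omega>. (\<Prod>q\<in>J. f (p m q \<omega>)) * (\<Prod>q\<in>J. r m q \<omega>) \<partial>M)
        = (\<integral>\<omega>. (\<Prod>q\<in>J. f (p m q \<omega>)) * (\<Prod>q\<in>J. c m q \<omega> * h (p m q \<omega>)) \<partial>M)"
        unfolding r_def c_def p_def
      proof (rule integral_sole_retained)
        show "finite J"
          using finite_subset[OF that Q] .
        show "disjoint_family_on (grid_cell B m) J"
          by (auto simp: disjoint_family_on_def grid_cell_def)
        show "(\<lambda>\<omega>. \<Prod>q\<in>J. f (sole_point (grid_cell B m q) (U \<omega>))) \<in> borel_measurable F"
          using p_F unfolding p_def by (intro borel_measurable_prod)
        show "\<bar>\<Prod>q\<in>J. f (sole_point (grid_cell B m q) (U \<omega>))\<bar> \<le> 2 ^ card J" for \<omega>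
          using bnd[of "\<lambda>_. 1" "\<lambda>q. f (sole_point (grid_cell B m q) (U \<omega>))" J] f_abs by simp
      qed (rule C)+
      then show ?thesis
        by (simp only: prod.distrib mult.commute mult.left_commute mult.assoc)
    qed
    have int_r: "integrable M (\<lambda>\<omega>. \<Prod>q\<in>J. r m q \<omega> * f (p m q \<omega>))" for J
      using bnd[OF r_le f_abs] r_M p_M
      by (intro integrable_const_bound[where B = "2 ^ card J"] borel_measurable_prod borel_measurable_times AE_I2)
        auto
    have int_c: "integrable M (\<lambda>\<omega>. \<Prod>q\<in>J. c m q \<omega> * (f (p m q \<omega>) * h (p m q \<omega>)))" for J
      using bnd[OF c_le fh_abs] c_M p_M hp_M
      by (intro integrable_const_bound[where B = "2 ^ card J"] borel_measurable_prod borel_measurable_times AE_I2)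
        auto
    have "(\<integral>\<omega>. (\<Prod>q\<in>Q m. 1 - r m q \<omega> * f (p m q \<omega>)) \<partial>M)
        = (\<Sum>J\<in>Pow (Q m). (- 1) ^ card J * (\<integral>\<omega>. (\<Prod>q\<in>J. r m q \<omega> * f (p m q \<omega>)) \<partial>M))"
      unfolding prod_diff_conv_sum[OF Q] prod.neutral_const mult_1_right
      using int_r by (simp add: Bochner_Integration.integral_sum)
    also have "\<dots> = (\<Sum>J\<in>Pow (Q m). (- 1) ^ card J
        * (\<integral>\<omega>. (\<Prod>q\<in>J. c m q \<omega> * (f (p m q \<omega>) * h (p m q \<omega>))) \<partial>M))"
      by (intro sum.cong refl) (simp only: summand Pow_iff)
    also have "\<dots> = (\<integral>\<omega>. (\<Prod>q\<in>Q m. 1 - c m q \<omega> * (f (p m q \<omega>) * h (p m q \<omega>))) \<partial>M)"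
      unfolding prod_diff_conv_sum[OF Q] prod.neutral_const mult_1_right
      using int_c by (simp add: Bochner_Integration.integral_sum)
    finally show ?thesis .
  qed
  have le1: "\<bar>\<Prod>q\<in>J. 1 - of_bool (b q) * a q\<bar> \<le> 1"
    if "\<And>q. 0 \<le> a q" "\<And>q. a q \<le> 2" for b J and a :: "('a \<Rightarrow> int) \<Rightarrow> real"
  proof (rule abs_prod_le_1)
    show "\<bar>1 - of_bool (b q) * a q\<bar> \<le> 1" for q
      using that[of q] by (cases "b q") (auto simp: abs_le_iff)
  qed
  have U_prod_M: "(\<lambda>\<omega>. \<Prod>q\<in>Q m. 1 - c m q \<omega> * (f (p m q \<omega>) * h (p m q \<omega>))) \<in> borel_measurable M" for m
    using c_M p_M hp_M
    by (intro borel_measurable_prod borel_measurable_diff borel_measurable_times borel_measurable_const)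
  have S_lim: "(\<lambda>m. \<Prod>q\<in>Q m. 1 - r m q \<omega> * f (p m q \<omega>)) \<longlonglongrightarrow> (\<Prod>x\<in>S \<omega> \<inter> B. 1 - f x)"
    and U_lim: "(\<lambda>m. \<Prod>q\<in>Q m. 1 - c m q \<omega> * (f (p m q \<omega>) * h (p m q \<omega>))) \<longlonglongrightarrow> (\<Prod>x\<in>U \<omega> \<inter> B. 1 - f x * h x)"
    if "\<omega> \<in> space M" for \<omega>
    using prod_retained_tendsto[OF B(2) that, of f] prod_thinned_tendsto[OF B(2) that, of "\<lambda>x. f x * h x"]
    by (simp_all add: Q_def r_def c_def p_def)
  have "(\<lambda>m. \<integral>\<omega>. (\<Prod>q\<in>Q m. 1 - r m q \<omega> * f (p m q \<omega>)) \<partial>M) \<longlonglongrightarrow> (\<integral>\<omega>. (\<Prod>x\<in>S \<omega> \<inter> B. (1 - f x)) \<partial>M)"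
  proof (rule integral_dominated_convergence[where w = "\<lambda>_. 1"])
    show "AE \<omega> in M. norm (\<Prod>q\<in>Q m. 1 - r m q \<omega> * f (p m q \<omega>)) \<le> 1" for m
      unfolding r_def real_norm_def using f_range by (intro AE_I2 le1)
    show "(\<lambda>\<omega>. \<Prod>q\<in>Q m. 1 - r m q \<omega> * f (p m q \<omega>)) \<in> borel_measurable M" for m
      unfolding Q_def r_def p_def by (rule measurable_prod_retained_cells[OF B f])
  qed (use measurable_prod_retained[OF B f] S_lim in \<open>auto intro!: AE_I2\<close>)
  moreover have "(\<lambda>m. \<integral>\<omega>. (\<Prod>q\<in>Q m. 1 - c m q \<omega> * (f (p m q \<omega>) * h (p m q \<omega>))) \<partial>M)
      \<longlonglongrightarrow> (\<integral>\<omega>. (\<Prod>x\<in>U \<omega> \<inter> B. (1 - f x * h x)) \<partial>M)"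
  proof (rule integral_dominated_convergence[where w = "\<lambda>_. 1"])
    show "AE \<omega> in M. norm (\<Prod>q\<in>Q m. 1 - c m q \<omega> * (f (p m q \<omega>) * h (p m q \<omega>))) \<le> 1" for m
      unfolding c_def real_norm_def using fh_range by (intro AE_I2 le1)
    show "(\<lambda>\<omega>. \<Prod>x\<in>U \<omega> \<inter> B. 1 - f x * h x) \<in> borel_measurable M"
      by (rule borel_measurable_LIMSEQ_real[OF U_lim U_prod_M])
  qed (use U_prod_M U_lim in \<open>auto intro!: AE_I2\<close>)
  ultimately show ?thesis
    unfolding cells by (rule LIMSEQ_unique)
qed

lemma set_integrable_thinned:
  assumes P: "poisson_process M \<phi> U" and B: "B \<in> sets borel" "bounded B"
  shows "set_integrable lborel B (\<lambda>x. \<phi> x * h x)"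
proof (rule set_integrable_bound)
  show "set_integrable lborel B \<phi>"
    using P B by (simp add: poisson_process_def)
  have [measurable]: "\<phi> \<in> borel_measurable borel"
    using P by (simp add: poisson_process_def)
  show "set_borel_measurable lborel B (\<lambda>x. \<phi> x * h x)"
    unfolding set_borel_measurable_def using B by measurable
  show "AE x in lborel. x \<in> B \<longrightarrow> norm (\<phi> x * h x) \<le> norm (\<phi> x)"
    using h_range by (intro AE_I2) (simp add: abs_mult mult_left_le)
qed

text \<open>
  The generating functionals are evaluated at the function with value \<open>1 - s i\<close> on \<open>B i\<close> and \<open>0\<close>
  outside these sets.
\<close>

lemma retained_joint_pgf:
  fixes B :: "'i \<Rightarrow> 'a set" and s :: "'i \<Rightarrow> real"
  assumes P: "poisson_process M \<phi> U"
    and I: "finite I" and B: "\<And>i. i \<in> I \<Longrightarrow> B i \<in> sets borel" "\<And>i. i \<in> I \<Longrightarrow> bounded (B i)"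
    and disj: "disjoint_family_on B I"
    and s: "\<And>i. i \<in> I \<Longrightarrow> \<bar>s i\<bar> \<le> 1"
  shows "(\<integral>\<omega>. (\<Prod>i\<in>I. s i ^ card (S \<omega> \<inter> B i)) \<partial>M)
    = (\<Prod>i\<in>I. exp (- ((1 - s i) * (LINT x:B i|lborel. \<phi> x * h x))))"
proof -
  define D where "D = (\<Union>i\<in>I. B i)"
  have D: "D \<in> sets borel" "bounded D"
    using I B by (auto simp: D_def)
  define f where "f x = (\<Sum>i\<in>I. (1 - s i) * indicator (B i) x)" for x
  have f_eq: "f x = 1 - s i" if "i \<in> I" "x \<in> B i" for i x
  proof -
    have "f x = (\<Sum>j\<in>I. if j = i then 1 - s i else 0)"
      unfolding f_def using disj that
      by (intro sum.cong) (auto simp: indicator_def disjoint_family_on_def)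
    then show ?thesis using I that by simp
  qed
  have f_out: "f x = 0" if "x \<notin> D" for x
    using that unfolding f_def D_def by (intro sum.neutral) auto
  have f_range: "0 \<le> f x" "f x \<le> 2" for x
  proof -
    have "0 \<le> f x \<and> f x \<le> 2"
    proof (cases "x \<in> D")
      case True
      then obtain i where "i \<in> I" "x \<in> B i"
        by (auto simp: D_def)
      then show ?thesis using f_eq s[of i] by (auto simp: abs_le_iff)
    qed (simp add: f_out)
    then show "0 \<le> f x" "f x \<le> 2" by auto
  qed
  have f_meas [measurable]: "f \<in> borel_measurable borel"
    unfolding f_def using B
    by (intro borel_measurable_sum borel_measurable_times borel_measurable_indicator) auto
  have fh: "0 \<le> f x * h x" "f x * h x \<le> 2" for x
  proof -
    have "f x * h x \<le> 2 * 1"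
      using f_range[of x] h_range[of x] by (intro mult_mono) auto
    then show "0 \<le> f x * h x" "f x * h x \<le> 2"
      using f_range[of x] h_range[of x] by auto
  qed
  have "(\<Prod>i\<in>I. s i ^ card (S \<omega> \<inter> B i)) = (\<Prod>x\<in>S \<omega> \<inter> D. 1 - f x)" if "\<omega> \<in> space M" for \<omega>
  proof -
    have "(\<Prod>x\<in>S \<omega> \<inter> D. 1 - f x) = (\<Prod>x\<in>(\<Union>i\<in>I. S \<omega> \<inter> B i). 1 - f x)"
      by (intro prod.cong) (auto simp: D_def)
    also have "\<dots> = (\<Prod>i\<in>I. \<Prod>x\<in>S \<omega> \<inter> B i. 1 - f x)"
      using I finite_S[OF that] B disj
      by (intro prod.UNION_disjoint) (simp_all add: disjoint_family_on_def, blast)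
    also have "\<dots> = (\<Prod>i\<in>I. \<Prod>x\<in>S \<omega> \<inter> B i. s i)"
      using f_eq by (intro prod.cong) auto
    finally show ?thesis by simp
  qed
  then have "(\<integral>\<omega>. (\<Prod>i\<in>I. s i ^ card (S \<omega> \<inter> B i)) \<partial>M) = (\<integral>\<omega>. (\<Prod>x\<in>S \<omega> \<inter> D. 1 - f x) \<partial>M)"
    by (intro Bochner_Integration.integral_cong refl)
  also have "\<dots> = (\<integral>\<omega>. (\<Prod>x\<in>U \<omega> \<inter> D. 1 - f x * h x) \<partial>M)"
    using D f_meas f_range by (rule expectation_prod_retained)
  also have "\<dots> = exp (- (LINT x:D|lborel. \<phi> x * (f x * h x)))"
    using fh by (intro poisson_process_pgfl[OF P D]) auto
  also have "(LINT x:D|lborel. \<phi> x * (f x * h x)) = (\<Sum>i\<in>I. (1 - s i) * (LINT x:B i|lborel. \<phi> x * h x))"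
  proof -
    have "indicator D x *\<^sub>R (\<phi> x * (f x * h x))
        = (\<Sum>i\<in>I. (1 - s i) * (indicator (B i) x *\<^sub>R (\<phi> x * h x)))" for x
    proof -
      have "indicator D x *\<^sub>R (\<phi> x * (f x * h x)) = f x * (\<phi> x * h x)"
        by (cases "x \<in> D") (auto simp: f_out)
      then show ?thesis
        unfolding f_def sum_distrib_right by (simp add: mult.assoc)
    qed
    moreover have "integrable lborel (\<lambda>x. indicator (B i) x *\<^sub>R (\<phi> x * h x))" if "i \<in> I" for i
      using set_integrable_thinned[OF P B[OF that]] by (simp add: set_integrable_def)
    ultimately show ?thesis
      unfolding set_lebesgue_integral_def by (simp add: Bochner_Integration.integral_sum)
  qed
  finally show ?thesis
    using I by (simp add: exp_sum flip: sum_negf)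
qed

theorem poisson_process_retained:
  assumes P: "poisson_process M \<phi> U"
  shows "poisson_process M (\<lambda>x. \<phi> x * h x) S"
proof -
  have \<phi>: "\<phi> \<in> borel_measurable borel" "\<And>x. 0 \<le> \<phi> x"
    using P by (simp_all add: poisson_process_def)
  define mean where "mean B = (LINT x:B|lborel. \<phi> x * h x)" for B
  have joint: "prob {\<omega>\<in>space M. \<forall>i\<in>I. card (S \<omega> \<inter> B i) = k i}
      = (\<Prod>i\<in>I. mean (B i) ^ k i / fact (k i) * exp (- mean (B i)))"
    if "finite I" "\<And>i. i \<in> I \<Longrightarrow> B i \<in> sets borel" "\<And>i. i \<in> I \<Longrightarrow> bounded (B i)"
      "disjoint_family_on B I" for I :: "nat set" and B k
    unfolding mean_def
  proof (rule poisson_joint_pmf_of_joint_pgf[OF that(1)])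
    show "(\<lambda>\<omega>. card (S \<omega> \<inter> B i)) \<in> measurable M (count_space UNIV)" if "i \<in> I" for i
      using that \<open>\<And>i. i \<in> I \<Longrightarrow> B i \<in> sets borel\<close> \<open>\<And>i. i \<in> I \<Longrightarrow> bounded (B i)\<close>
      by (intro measurable_count[OF S_measurable])
  qed (rule retained_joint_pgf[OF P that])
  have marginal: "prob {\<omega>\<in>space M. card (S \<omega> \<inter> B) = k} = mean B ^ k / fact k * exp (- mean B)"
    if "B \<in> sets borel" "bounded B" for B k
    using joint[of "{0}" "\<lambda>_. B" "\<lambda>_. k"] that by (simp add: disjoint_family_on_def)
  have indep: "indep_vars (\<lambda>_. count_space UNIV) (\<lambda>i \<omega>. card (S \<omega> \<inter> B i)) {..<n}"
    if B: "\<forall>i<n. B i \<in> sets borel \<and> bounded (B i)" and disj: "disjoint_family_on B {..<n}"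
    for n :: nat and B
  proof (cases "n = 0")
    case True
    then show ?thesis by (simp add: indep_vars_def indep_sets_def)
  next
    case False
    show ?thesis
    proof (rule indep_vars_countableI)
      show "(\<lambda>\<omega>. card (S \<omega> \<inter> B i)) \<in> measurable M (count_space UNIV)" if "i \<in> {..<n}" for i
        using B that by (intro measurable_count[OF S_measurable]) auto
      show "prob {\<omega>\<in>space M. \<forall>i\<in>{..<n}. card (S \<omega> \<inter> B i) = k i}
          = (\<Prod>i\<in>{..<n}. prob {\<omega>\<in>space M. card (S \<omega> \<inter> B i) = k i})" for k
        using B disj by (subst joint) (auto intro!: prod.cong simp: marginal)
    qed (use False in auto)
  qed
  show ?thesis
    unfolding poisson_process_def
    using prob_space_axioms \<phi> h_range S_measurable marginal indep set_integrable_thinned[OF P]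
    by (simp add: mean_def)
qed

end

section \<open>Groups shared by two vertices\<close>

lemma all_less_double: "(\<forall>i<2 * n. P i) \<longleftrightarrow> (\<forall>i<n. P (2 * i) \<and> P (2 * i + 1))" for n :: nat
proof
  assume *: "\<forall>i<n. P (2 * i) \<and> P (2 * i + 1)"
  show "\<forall>i<2 * n. P i"
  proof (intro allI impI)
    fix i assume "i < 2 * n"
    then have "i div 2 < n" by auto
    with * show "P i"
      by (cases "even i") (auto elim!: evenE oddE)
  qed
qed auto

lemma prod_less_double: "(\<Prod>i<2 * n. F i) = (\<Prod>i<n. F (2 * i) * F (2 * i + 1))"
  for F :: "nat \<Rightarrow> 'b::comm_monoid_mult"
  by (induction n) (simp_all add: mult.assoc)

text \<open>
  To retain \<open>n\<close> groups means to connect \<open>2 * n\<close> distinct pairs: pair \<open>i\<close> joins the group \<open>u (i div 2)\<close> to \<open>0\<close>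
  for even \<open>i\<close> and to \<open>v\<close> for odd \<open>i\<close>. The conditional probability of this event is integrated against the
  weight by the defining property of conditional expectation.
\<close>

lemma independent_thinning_shared_groups:
  fixes g :: "'a::euclidean_space \<Rightarrow> real" and U V :: "'w \<Rightarrow> 'a set"
  assumes M: "prob_space M"
    and g: "g \<in> borel_measurable borel" "\<And>x. 0 \<le> g x" "\<And>x. g x \<le> 1" "\<And>x. g (- x) = g x"
    and "v \<noteq> 0"
    and U: "U \<in> measurable M config_space"
    and V: "V \<in> measurable M config_space" "\<And>\<omega>. 0 \<in> V \<omega>" "\<And>\<omega>. v \<in> V \<omega>"
    and conn: "independently_connected M g V U conn"
  shows "independent_thinning M (points_algebra M V U) (\<lambda>x. g x * g (v - x)) U
    (\<lambda>\<omega>. shared_groups (U \<omega>) (conn \<omega>) 0 v)"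
proof -
  interpret prob_space M by (rule M)
  let ?F = "points_algebra M V U" and ?S = "\<lambda>\<omega>. shared_groups (U \<omega>) (conn \<omega>) 0 v"
  have VU: "(\<lambda>\<omega>. (V \<omega>, U \<omega>)) \<in> measurable M (config_space \<Otimes>\<^sub>M config_space)"
    using V(1) U by (rule measurable_Pair)
  have subalg: "subalgebra M ?F"
    unfolding subalgebra_def points_algebra_def
    using VU measurable_space[OF VU]
    by (auto simp: sets_vimage_algebra2 intro: measurable_sets)
  interpret finite_measure_subalgebra M ?F
    by standard (rule subalg)
  have U_F: "U \<in> measurable ?F config_space"
  proof -
    have "(\<lambda>\<omega>. (V \<omega>, U \<omega>)) \<in> measurable ?F (config_space \<Otimes>\<^sub>M config_space)"
      unfolding points_algebra_def using measurable_space[OF VU]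
      by (intro measurable_vimage_algebra1) auto
    from measurable_compose[OF this measurable_snd] show ?thesis by simp
  qed
  have [measurable]: "g \<in> borel_measurable borel" by (rule g)
  show ?thesis
  proof (intro independent_thinning.intro independent_thinning_axioms.intro)
    show "subalgebra M ?F" "U \<in> measurable ?F config_space"
      by (fact subalg U_F)+
    show "(\<lambda>x. g x * g (v - x)) \<in> borel_measurable borel"
      by measurable
    show "0 \<le> g x * g (v - x)" "g x * g (v - x) \<le> 1" for x
      using g(2,3) by (auto intro: mult_le_one)
    show "?S \<omega> \<subseteq> U \<omega>" for \<omega>
      by (auto simp: shared_groups_def)
    fix n :: nat and A :: "'w set" and u :: "nat \<Rightarrow> 'w \<Rightarrow> 'a" and W :: "'w \<Rightarrow> real" and C :: real
    assume A: "A \<in> sets ?F"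
      and u: "\<And>i. i < n \<Longrightarrow> u i \<in> borel_measurable ?F"
      and u_mem: "\<And>\<omega> i. \<omega> \<in> A \<Longrightarrow> i < n \<Longrightarrow> u i \<omega> \<in> U \<omega>"
      and u_inj: "\<And>\<omega>. \<omega> \<in> A \<Longrightarrow> inj_on (\<lambda>i. u i \<omega>) {..<n}"
      and W: "W \<in> borel_measurable ?F" "\<And>\<omega>. \<bar>W \<omega>\<bar> \<le> C"
    define w' where "w' i \<omega> = (if even i then 0 else v)" for i :: nat and \<omega> :: 'w
    define u' where "u' i \<omega> = u (i div 2) \<omega>" for i \<omega>
    define R where "R = {\<omega>\<in>A. \<forall>i<n. u i \<omega> \<in> ?S \<omega>}"
    have R': "{\<omega>\<in>A. \<forall>i<2 * n. conn \<omega> (w' i \<omega>) (u' i \<omega>)} = R"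
      unfolding R_def all_less_double using u_mem by (auto simp: w'_def u'_def shared_groups_def)
    have pairs_inj: "inj_on (\<lambda>i. (w' i \<omega>, u' i \<omega>)) {..<2 * n}" if "\<omega> \<in> A" for \<omega>
    proof (rule inj_onI)
      fix i j assume ij: "i \<in> {..<2 * n}" "j \<in> {..<2 * n}" "(w' i \<omega>, u' i \<omega>) = (w' j \<omega>, u' j \<omega>)"
      then have "even i = even j"
        using \<open>v \<noteq> 0\<close> by (auto simp: w'_def split: if_splits)
      moreover have "i div 2 = j div 2"
        using u_inj[OF that] ij by (auto simp: u'_def dest: inj_onD)
      ultimately show "i = j" by presburger
    qed
    have "R \<in> sets M \<and> (AE \<omega> in M. \<omega> \<in> A \<longrightarrow>
        real_cond_exp M ?F (indicator R) \<omega> = (\<Prod>i<2 * n. g (w' i \<omega> - u' i \<omega>)))"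
      unfolding R'[symmetric]
    proof (rule conn[unfolded independently_connected_def, rule_format], intro conjI allI impI ballI)
      show "A \<in> sets ?F" by (fact A)
      show "w' i \<in> borel_measurable ?F" for i
        by (simp add: w'_def[abs_def])
      show "u' i \<in> borel_measurable ?F" if "i < 2 * n" for i
        unfolding u'_def using u[of "i div 2"] that by auto
      show "w' i \<omega> \<in> V \<omega>" for i \<omega>
        using V by (simp add: w'_def)
      show "u' i \<omega> \<in> U \<omega>" if "\<omega> \<in> A" "i < 2 * n" for i \<omega>
        unfolding u'_def using that by (intro u_mem) auto
    qed (rule pairs_inj)
    moreover have "(\<Prod>i<2 * n. g (w' i \<omega> - u' i \<omega>)) = (\<Prod>i<n. g (u i \<omega>) * g (v - u i \<omega>))" for \<omega>
      unfolding prod_less_double by (simp add: w'_def u'_def g(4))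
    ultimately have R: "R \<in> sets M"
      and R_cond: "AE \<omega> in M. \<omega> \<in> A \<longrightarrow>
        real_cond_exp M ?F (indicator R) \<omega> = (\<Prod>i<n. g (u i \<omega>) * g (v - u i \<omega>))"
      by simp_all
    have A_M: "A \<in> sets M"
      using A subalg by (auto simp: subalgebra_def)
    have u_M: "u i \<in> borel_measurable M" if "i < n" for i
      using u[OF that] by (rule measurable_from_subalg[OF subalg])
    have W_M: "W \<in> borel_measurable M"
      using W(1) by (rule measurable_from_subalg[OF subalg])
    have WA_F: "(\<lambda>\<omega>. W \<omega> * indicator A \<omega>) \<in> borel_measurable ?F"
      using W A by (intro borel_measurable_times borel_measurable_indicator)
    have "C \<ge> 0"
      using W(2)[of undefined] by linarith
    have "(\<integral>\<omega>. W \<omega> * indicator R \<omega> \<partial>M) = (\<integral>\<omega>. (W \<omega> * indicator A \<omega>) * indicator R \<omega> \<partial>M)"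
      by (intro Bochner_Integration.integral_cong refl) (auto simp: R_def indicator_def)
    also have "\<dots> = (\<integral>\<omega>. (W \<omega> * indicator A \<omega>) * real_cond_exp M ?F (indicator R) \<omega> \<partial>M)"
    proof (rule real_cond_exp_intg(2)[symmetric, OF _ WA_F])
      show "integrable M (\<lambda>\<omega>. W \<omega> * indicator A \<omega> * indicat_real R \<omega>)"
        using W(2) W_M A_M R \<open>C \<ge> 0\<close>
        by (intro integrable_const_bound[where B = C]) (auto simp: indicator_def)
    qed (use R in simp)
    also have "\<dots> = (\<integral>\<omega>. W \<omega> * (indicator A \<omega> * (\<Prod>i<n. g (u i \<omega>) * g (v - u i \<omega>))) \<partial>M)"
    proof (rule integral_cong_AE)
      show "AE \<omega> in M. W \<omega> * indicator A \<omega> * real_cond_exp M ?F (indicator R) \<omega>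
          = W \<omega> * (indicator A \<omega> * (\<Prod>i<n. g (u i \<omega>) * g (v - u i \<omega>)))"
        using R_cond by eventually_elim (simp add: indicator_def)
      have "(\<lambda>\<omega>. \<Prod>i<n. g (u i \<omega>) * g (v - u i \<omega>)) \<in> borel_measurable M"
        using u_M by (intro borel_measurable_prod borel_measurable_times) auto
      then show "(\<lambda>\<omega>. W \<omega> * (indicator A \<omega> * (\<Prod>i<n. g (u i \<omega>) * g (v - u i \<omega>)))) \<in> borel_measurable M"
        using W_M A_M by (intro borel_measurable_times borel_measurable_indicator)
    qed (use W_M A_M in simp)
    finally show "{\<omega>\<in>A. \<forall>i<n. u i \<omega> \<in> ?S \<omega>} \<in> sets M \<and>
      (\<integral>\<omega>. W \<omega> * indicator {\<omega>\<in>A. \<forall>i<n. u i \<omega> \<in> ?S \<omega>} \<omega> \<partial>M)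
        = (\<integral>\<omega>. W \<omega> * (indicator A \<omega> * (\<Prod>i<n. g (u i \<omega>) * g (v - u i \<omega>))) \<partial>M)"
      using R unfolding R_def by blast
  qed (fact M)
qed

theorem proposition1:
  fixes M :: "'w measure"
    and g :: "real ^ 'd \<Rightarrow> real"
    and \<mu> lam :: real
    and v :: "real ^ 'd"
    and U V\<^sub>0 V :: "'w \<Rightarrow> (real ^ 'd) set"
    and conn :: "'w \<Rightarrow> real ^ 'd \<Rightarrow> real ^ 'd \<Rightarrow> bool"
  assumes "prob_space M"
    and "\<mu> > 0" and "lam > 0"
    and "\<And>x. g x \<in> {0..1}" and "nonincreasing_radial g"
    and "integrable lborel g" and "(LINT x|lborel. g x) > 0"
    and "v \<noteq> 0"
    and "homogeneous_poisson_process M \<mu> U"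
    and "homogeneous_poisson_process M lam V\<^sub>0"
    and "prob_space.indep_var M config_space V\<^sub>0 config_space U"
    and "\<And>\<omega>. V \<omega> = V\<^sub>0 \<omega> \<union> {0, v}"
    and "independently_connected M g V U conn"
  shows "poisson_process M (\<lambda>x. \<mu> * g x * g (v - x)) (\<lambda>\<omega>. shared_groups (U \<omega>) (conn \<omega>) 0 v)"
proof -
  interpret prob_space M by fact
  have P: "poisson_process M (\<lambda>_. \<mu>) U"
    using \<open>homogeneous_poisson_process M \<mu> U\<close> by (simp add: homogeneous_poisson_process_def)
  have "V\<^sub>0 \<in> measurable M config_space"
    using \<open>homogeneous_poisson_process M lam V\<^sub>0\<close>
    by (simp add: homogeneous_poisson_process_def poisson_process_measurable)
  then have "(\<lambda>\<omega>. insert 0 (insert v (V\<^sub>0 \<omega>))) \<in> measurable M config_space"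
    by (intro measurable_insert_point)
  moreover have V: "V = (\<lambda>\<omega>. insert 0 (insert v (V\<^sub>0 \<omega>)))"
    using \<open>\<And>\<omega>. V \<omega> = V\<^sub>0 \<omega> \<union> {0, v}\<close> by auto
  ultimately have V_meas: "V \<in> measurable M config_space"
    by simp
  have "independent_thinning M (points_algebra M V U) (\<lambda>x. g x * g (v - x)) U
      (\<lambda>\<omega>. shared_groups (U \<omega>) (conn \<omega>) 0 v)"
  proof (rule independent_thinning_shared_groups)
    show "g \<in> borel_measurable borel"
      using borel_measurable_integrable[OF \<open>integrable lborel g\<close>] by simp
    show "0 \<le> g x" "g x \<le> 1" for x
      using \<open>\<And>x. g x \<in> {0..1}\<close>[of x] by auto
    show "g (- x) = g x" for x
      using \<open>nonincreasing_radial g\<close> unfolding nonincreasing_radial_def by (metis norm_minus_cancel)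
    show "U \<in> measurable M config_space"
      using P by (rule poisson_process_measurable)
    show "0 \<in> V \<omega>" "v \<in> V \<omega>" for \<omega>
      by (simp_all add: V)
  qed (fact \<open>prob_space M\<close> \<open>v \<noteq> 0\<close> V_meas \<open>independently_connected M g V U conn\<close>)+
  from independent_thinning.poisson_process_retained[OF this P]
  show ?thesis by (simp add: mult.assoc)
qed

end
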